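(* Fix $j\in\{1,\dots,d\}$ and, for $t>0$, define $T^j:z\mapsto\frac{z-\lambda_j}{\sqrt{t\alpha_j/\alpha}}$. Then the push-forward $T^j_{\#}\mu_t=\mu_t\big(\lambda_j+\cdot\,\sqrt{t\alpha_j/\alpha}\big)$ of $\mu_t$ under $T^j$ converges vaguely, as $t\to0$ ($t>0$), to $\frac{\alpha_j}{\alpha}\,\mathsf{sc}_1$.
   Context: $d\in\mathbb{N}$, $\lambda_1,\dots,\lambda_d\in\mathbb{C}$ are distinct, $\alpha_1,\dots,\alpha_d\in\mathbb{N}=\{1,2,\dots\}$, $\alpha=\sum_j\alpha_j$, $P(z)=\prod_{j=1}^d(z-\lambda_j)^{\alpha_j}$, $P^n$ is the $n$-th power of $P$, and $P_t^n=e^{-\frac{t}{2\alpha n}\partial_z^2}P^n=\sum_{k\ge0}\frac{1}{k!}(-\frac{t}{2\alpha n})^k\partial_z^{2k}P^n$. For $t>0$, $\mu_t$ is the weak limit as $n\to\infty$ of $\mu_{n,t}=\frac1{\alpha n}\sum_{\lambda:P_t^n(\lambda)=0}\delta_\lambda$ (zeros counted with multiplicity); this limit exists and is a compactly supported probability measure on $\mathbb{C}$. $\mathsf{sc}_1$ is the standard semicircle law, with density $x\mapsto\frac1{2\pi}\sqrt{4-x^2}$ on $[-2,2]\subset\mathbb{R}$, viewed as a measure on $\mathbb{C}$. Vague convergence means convergence of integrals against continuous compactly supported functions on $\mathbb{C}$. *)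

theory Defs
  imports "HOL-Probability.Probability" "HOL-Computational_Algebra.Polynomial"
begin

definition total_mult :: "nat \<Rightarrow> (nat \<Rightarrow> nat) \<Rightarrow> nat" where
  "total_mult d a = (\<Sum>j=1..d. a j)"

definition base_poly :: "nat \<Rightarrow> (nat \<Rightarrow> complex) \<Rightarrow> (nat \<Rightarrow> nat) \<Rightarrow> complex poly" where
  "base_poly d lam a = (\<Prod>j=1..d. [:- lam j, 1:] ^ a j)"

text \<open>The operator \<open>exp (- s \<partial>\<^sup>2)\<close> on polynomials. The exponential series is cut off at
  \<open>k = degree p\<close>, since \<open>\<partial>\<^sup>2\<^sup>k p = 0\<close> as soon as \<open>2 k > degree p\<close>.\<close>

definition heat_flow :: "real \<Rightarrow> complex poly \<Rightarrow> complex poly" where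
  "heat_flow s p = (\<Sum>k\<le>degree p. smult (complex_of_real ((- s) ^ k / fact k)) ((pderiv ^^ (2 * k)) p))"

text \<open>In \<open>evolved_poly\<close> and \<open>empirical_zeros\<close> only \<open>n \<ge> 1\<close> is meaningful; \<open>n = 0\<close> divides by zero.\<close>

definition evolved_poly ::
    "nat \<Rightarrow> (nat \<Rightarrow> complex) \<Rightarrow> (nat \<Rightarrow> nat) \<Rightarrow> nat \<Rightarrow> real \<Rightarrow> complex poly" where
  "evolved_poly d lam a n t =
     heat_flow (t / (2 * real (total_mult d a) * real n)) (base_poly d lam a ^ n)"

text \<open>The sum of the Dirac masses at the zeros of \<open>p \<noteq> 0\<close>, counted with multiplicity. The identity
  push-forward only serves to move the measure from the discrete \<open>\<sigma>\<close>-algebra on the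
  zero set to the Borel \<open>\<sigma>\<close>-algebra of the plane.\<close>

definition zeros_measure :: "complex poly \<Rightarrow> complex measure" where
  "zeros_measure p =
     distr (point_measure {z. poly p z = 0} (\<lambda>z. of_nat (order z p))) borel (\<lambda>z. z)"

definition empirical_zeros ::
    "nat \<Rightarrow> (nat \<Rightarrow> complex) \<Rightarrow> (nat \<Rightarrow> nat) \<Rightarrow> nat \<Rightarrow> real \<Rightarrow> complex measure" where
  "empirical_zeros d lam a n t =
     scale_measure (ennreal (1 / (real (total_mult d a) * real n)))
       (zeros_measure (evolved_poly d lam a n t))"

text \<open>Both notions of convergence below are meant for finite Borel measures; then all integrals
  involved exist. (The library's \<^const>\<open>weak_conv_m\<close> is restricted to measures on the
  real line.)\<close>

definition weakly_tendsto ::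
    "('i \<Rightarrow> 'a::topological_space measure) \<Rightarrow> 'a measure \<Rightarrow> 'i filter \<Rightarrow> bool" where
  "weakly_tendsto M N F \<longleftrightarrow>
     (\<forall>f :: 'a \<Rightarrow> real. continuous_on UNIV f \<longrightarrow> bounded (range f) \<longrightarrow>
        ((\<lambda>i. integral\<^sup>L (M i) f) \<longlongrightarrow> integral\<^sup>L N f) F)"

definition vaguely_tendsto ::
    "('i \<Rightarrow> 'a::topological_space measure) \<Rightarrow> 'a measure \<Rightarrow> 'i filter \<Rightarrow> bool" where
  "vaguely_tendsto M N F \<longleftrightarrow>
     (\<forall>f :: 'a \<Rightarrow> real. continuous_on UNIV f \<longrightarrow> compact (closure {x. f x \<noteq> 0}) \<longrightarrow>
        ((\<lambda>i. integral\<^sup>L (M i) f) \<longlongrightarrow> integral\<^sup>L N f) F)"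

definition semicircle :: "complex measure" where
  "semicircle =
     distr (density lborel (\<lambda>x. ennreal (indicator {-2..2} x * (sqrt (4 - x\<^sup>2) / (2 * pi)))))
       borel complex_of_real"

end

theory Submission
  imports Defs "HOL-Complex_Analysis.Complex_Analysis" "HOL-Computational_Algebra.Fundamental_Theorem_Algebra"
begin

text \<open>
  Since \<open>exp (- s \<partial>\<^sup>2)\<close> acts on polynomials of degree \<open>N\<close> as an apolar pairing with a Hermite
  polynomial, whose zeros for \<open>s = t / (2 N)\<close> lie in \<open>[- 2 \<surd>t, 2 \<surd>t]\<close>, Grace's theorem shows that every
  disc around a zero \<open>z\<close> of the evolved polynomial containing \<open>[z - 2 \<surd>t, z + 2 \<surd>t]\<close> contains some
  \<open>\<lambda>\<^sub>i\<close>. Choosing the disc well, the zeros lie in clusters: \<open>\<bar>z - \<lambda>\<^sub>i\<bar> \<le> 2 \<surd>t\<close> and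
  \<open>\<bar>Im (z - \<lambda>\<^sub>i)\<bar> = O(t)\<close>, uniformly in \<open>n\<close>. So at scale \<open>\<surd>t\<close> the cluster at \<open>\<lambda>\<^sub>j\<close> becomes real, and only
  its holomorphic moments matter. By the heat equation and residues, these moments satisfy
  \<open>M\<^sub>k' = k / 2 \<Sum>\<^bsub>p+q=k-2\<^esub> M\<^sub>p M\<^sub>q\<close> up to \<open>O(1/N)\<close> terms and the bounded force exerted by the other
  clusters; hence \<open>M\<^sub>k\<close> is to leading order \<open>t\<^bsup>k/2\<^esup>\<close> times a constant obeying the Catalan recursion
  of the semicircle moments. Weierstrass approximation finishes the proof. Throughout \<open>\<tau> = \<surd>t\<close>, which
  keeps all these bounds polynomial.
\<close>

section \<open>Heat flow and Hermite polynomials\<close>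

text \<open>The limit in n comes first and is only known to exist, so every estimate is made at
  finite n with constants that depend on the gap \<sigma> between the roots but not on n; it then
  survives the limit at fixed t. The zeros start with high multiplicity and may collide, so their
  individual motion is singular. A power sum over a cluster is a contour integral over a fixed
  circle without zeros, and is differentiable down to \<tau> = 0. Holomorphic moments do not
  determine a planar measure: a rotation-invariant one has those of a point mass. Hence the need for
  the bound on imaginary parts, which are O(\<tau>^2) in a cluster of size \<tau>. Other clusters
  exert a force of order 1 / \<sigma>, while forces inside a cluster have order 1 / \<tau>; the
  ratio is the factor \<tau> that makes the clusters decouple. The mass \<beta> of a cluster, here
  \<alpha>_j / \<alpha>, also fixes its scale: the moment equation is quadratic in the mass, and
  only the standard deviation sqrt(\<beta>) \<tau> balances it. This is the normalisation of
  T^j.\<close>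

lemma higher_pderiv_eq_0:
  fixes p :: "complex poly"
  assumes "degree p < k"
  shows "(pderiv ^^ k) p = 0"
proof -
  have "coeff ((pderiv ^^ k) p) n = 0" for n
    using assms by (simp add: coeff_higher_pderiv coeff_eq_0)
  then show ?thesis by (intro poly_eqI) simp
qed

text \<open>The cut-off in \<open>heat_flow\<close> varies with the polynomial. A common
  \<open>K\<close> makes several such series comparable term by term.\<close>

lemma heat_flow_upto:
  assumes "degree p < 2 * K"
  shows "heat_flow s p = (\<Sum>k<K. smult (complex_of_real ((- s) ^ k / fact k)) ((pderiv ^^ (2 * k)) p))"
proof -
  define f where "f = (\<lambda>k. smult (complex_of_real ((- s) ^ k / fact k)) ((pderiv ^^ (2 * k)) p))"
  have z: "f k = 0" if "degree p < 2 * k" for k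
    using that by (simp add: f_def higher_pderiv_eq_0)
  have "sum f {..degree p} = sum f {..max (degree p) K}"
    by (rule sum.mono_neutral_left) (auto intro!: z)
  also have "\<dots> = sum f {..<K}"
    by (rule sum.mono_neutral_right) (use assms in \<open>auto intro!: z\<close>)
  finally show ?thesis by (simp add: heat_flow_def f_def)
qed

lemma heat_flow_add: "heat_flow s (p + q) = heat_flow s p + heat_flow s q"
proof -
  define K where "K = Suc (max (degree p) (degree q))"
  have "degree (p + q) \<le> max (degree p) (degree q)" by (rule degree_add_le) auto
  then show ?thesis
    by (simp add: heat_flow_upto[where K=K] K_def higher_pderiv_add smult_add_right sum.distrib
        del: sum.lessThan_Suc)
qed

lemma smult_sum_right: "smult c (sum f A) = (\<Sum>x\<in>A. smult c (f x))"
  by (induction A rule: infinite_finite_induct) (simp_all add: smult_add_right)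

lemma heat_flow_smult: "heat_flow s (smult c p) = smult c (heat_flow s p)"
proof -
  have "degree (smult c p) < 2 * Suc (degree p)" "degree p < 2 * Suc (degree p)" by simp_all
  then show ?thesis
    by (simp add: heat_flow_upto[where K="Suc (degree p)"] higher_pderiv_smult smult_sum_right mult_ac
        del: sum.lessThan_Suc)
qed

lemma heat_flow_0 [simp]: "heat_flow s 0 = 0"
  by (simp add: heat_flow_def)

lemma heat_flow_sum: "heat_flow s (sum f A) = (\<Sum>x\<in>A. heat_flow s (f x))"
  by (induction A rule: infinite_finite_induct) (simp_all add: heat_flow_add)

lemma higher_pderiv_pderiv: "(pderiv ^^ k) (pderiv p) = (pderiv ^^ (Suc k)) p"
  by (simp add: funpow_swap1)

lemma pderiv_sum: "pderiv (sum f A) = (\<Sum>x\<in>A. pderiv (f x))"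
  using higher_pderiv_sum[of 1 f A] by simp

lemma pderiv_heat_flow: "pderiv (heat_flow s p) = heat_flow s (pderiv p)"
proof -
  have "degree (pderiv p) < 2 * Suc (degree p)" "degree p < 2 * Suc (degree p)"
    by (simp_all add: degree_pderiv)
  then show ?thesis
    by (simp add: heat_flow_upto[where K="Suc (degree p)"] pderiv_sum pderiv_smult funpow_swap1
        del: sum.lessThan_Suc)
qed

lemma higher_pderiv_X_mult:
  "(pderiv ^^ k) ([:0, 1:] * p) = [:0, 1:] * (pderiv ^^ k) p + smult (of_nat k) ((pderiv ^^ (k - 1)) p)"
proof (induction k)
  case (Suc k)
  show ?case
  proof (cases k)
    case 0
    then show ?thesis by (simp add: pderiv_mult pderiv_pCons add.commute)
  next
    case (Suc m)
    have "(pderiv ^^ (Suc k)) ([:0, 1:] * p) = pderiv ((pderiv ^^ k) ([:0, 1:] * p))" by simp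
    also have "\<dots> = [:0, 1:] * (pderiv ^^ Suc k) p + (pderiv ^^ k) p + smult (of_nat k) ((pderiv ^^ k) p)"
      unfolding Suc.IH using Suc
      by (simp only: pderiv_add pderiv_mult pderiv_smult) (simp add: pderiv_pCons)
    finally show ?thesis by (simp add: smult_add_left algebra_simps)
  qed
qed simp

text \<open>The commutator of exp(-s D^2) with multiplication by x is -2 s D exp(-s D^2). On
  monomials it becomes the three-term recurrence of the Hermite polynomials.\<close>

lemma heat_flow_X_mult:
  "heat_flow s ([:0, 1:] * p) = [:0, 1:] * heat_flow s p - smult (of_real (2 * s)) (heat_flow s (pderiv p))"
proof -
  define K where "K = Suc (Suc (degree p))"
  define c where "c = (\<lambda>k. complex_of_real ((- s) ^ k / fact k))"
  have c_Suc: "c (Suc k) * of_nat (2 * Suc k) = - of_real (2 * s) * c k" for k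
  proof -
    have "(- s) ^ Suc k / fact (Suc k) * real (2 * Suc k) = - (2 * s) * ((- s) ^ k / fact k)"
      by (simp add: divide_simps)
    then show ?thesis
      unfolding c_def by (metis of_real_minus of_real_mult of_real_of_nat_eq)
  qed
  have "degree ([:0, 1:] * p) \<le> Suc (degree p)"
    using degree_mult_le[of "[:0, 1:]" p] by simp
  then have d: "degree ([:0, 1:] * p) < 2 * Suc K" "degree p < 2 * Suc K" "degree (pderiv p) < 2 * K"
    by (simp_all add: K_def degree_pderiv)
  have "heat_flow s ([:0, 1:] * p) = (\<Sum>k<Suc K. smult (c k) ((pderiv ^^ (2 * k)) ([:0, 1:] * p)))"
    using heat_flow_upto[OF d(1)] by (simp add: c_def)
  also have "\<dots> = [:0, 1:] * (\<Sum>k<Suc K. smult (c k) ((pderiv ^^ (2 * k)) p))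
      + (\<Sum>k<Suc K. smult (c k * of_nat (2 * k)) ((pderiv ^^ (2 * k - 1)) p))"
    unfolding higher_pderiv_X_mult
    by (simp only: smult_add_right sum.distrib sum_distrib_left mult_smult_right smult_smult)
  also have "(\<Sum>k<Suc K. smult (c k * of_nat (2 * k)) ((pderiv ^^ (2 * k - 1)) p))
      = (\<Sum>k<K. smult (c (Suc k) * of_nat (2 * Suc k)) ((pderiv ^^ (2 * Suc k - 1)) p))"
    by (subst sum.lessThan_Suc_shift) simp
  also have "\<dots> = - smult (of_real (2 * s)) (\<Sum>k<K. smult (c k) ((pderiv ^^ (2 * k)) (pderiv p)))"
    unfolding c_Suc by (simp add: smult_sum_right higher_pderiv_pderiv sum_negf del: funpow.simps)
  finally show ?thesis
    using heat_flow_upto[OF d(2), of s] heat_flow_upto[OF d(3), of s] by (simp add: c_def del: sum.lessThan_Suc)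
qed

lemma DERIV_heat_flow:
  "((\<lambda>s. poly (heat_flow s p) z) has_vector_derivative - poly (heat_flow s (pderiv (pderiv p))) z) (at s)"
proof -
  define K where "K = Suc (degree p)"
  define b where "b = (\<lambda>k. poly ((pderiv ^^ (2 * k)) p) z)"
  have d: "degree p < 2 * Suc K" "degree (pderiv (pderiv p)) < 2 * K"
    by (simp_all add: K_def degree_pderiv)
  have eq: "poly (heat_flow s p) z = (\<Sum>k<Suc K. ((- s) ^ k / fact k) *\<^sub>R b k)" for s
    unfolding heat_flow_upto[OF d(1)] by (simp add: poly_sum b_def scaleR_conv_of_real)
  have eq2: "poly (heat_flow s (pderiv (pderiv p))) z = (\<Sum>k<K. ((- s) ^ k / fact k) *\<^sub>R b (Suc k))" for s
    unfolding heat_flow_upto[OF d(2)]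
    by (simp add: poly_sum b_def scaleR_conv_of_real funpow_swap1)
  have "((\<lambda>s. \<Sum>k<Suc K. ((- s) ^ k / fact k) *\<^sub>R b k) has_vector_derivative
      (\<Sum>k<Suc K. (- (real k * (- s) ^ (k - 1) / fact k)) *\<^sub>R b k)) (at s)"
    by (rule derivative_eq_intros refl | simp)+
  also have "(\<Sum>k<Suc K. (- (real k * (- s) ^ (k - 1) / fact k)) *\<^sub>R b k)
      = (\<Sum>k<K. (- ((- s) ^ k / fact k)) *\<^sub>R b (Suc k))"
    by (subst sum.lessThan_Suc_shift) (simp add: field_simps del: of_nat_Suc)
  finally show ?thesis unfolding eq eq2 by (simp add: sum_negf)
qed

lemma coeff_heat_flow_top:
  assumes "degree p \<le> n"
  shows "coeff (heat_flow s p) n = coeff p n"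
proof -
  have "coeff ((pderiv ^^ (2 * Suc k)) p) n = 0" for k
    using assms by (simp add: coeff_higher_pderiv coeff_eq_0 del: funpow.simps)
  moreover have "degree p < 2 * Suc (degree p)" by simp
  ultimately show ?thesis
    by (subst heat_flow_upto[where K="Suc (degree p)"], simp, subst sum.lessThan_Suc_shift)
       (simp add: coeff_sum del: funpow.simps)
qed

lemma degree_heat_flow [simp]: "degree (heat_flow s p) = degree p"
proof (cases "p = 0")
  case False
  have "degree (heat_flow s p) \<le> degree p"
    by (rule degree_le) (simp add: coeff_heat_flow_top coeff_eq_0)
  moreover have "coeff (heat_flow s p) (degree p) \<noteq> 0"
    using False by (simp add: coeff_heat_flow_top)
  ultimately show ?thesis using le_degree by (metis antisym)
qed simp

text \<open>For s > 0 this is the probabilists' Hermite polynomial rescaled to variance 2 s, that is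
  (2 s)^(l/2) He_l(x / sqrt(2 s)); for s = 0 it is x^l.\<close>

definition hermite :: "real \<Rightarrow> nat \<Rightarrow> complex poly" where
  "hermite s l = heat_flow s (monom 1 l)"

lemma hermite_0 [simp]: "hermite s 0 = 1"
  by (simp add: hermite_def heat_flow_def one_pCons monom_0)

lemma degree_hermite [simp]: "degree (hermite s n) = n"
  by (simp add: hermite_def degree_monom_eq)

lemma lead_coeff_hermite: "coeff (hermite s n) n = 1"
  by (simp add: hermite_def coeff_heat_flow_top degree_monom_eq)

text \<open>For n = 0 the truncated index \<open>n - 1\<close> is harmless, since its coefficient is
  0.\<close>

lemma hermite_Suc:
  "hermite s (Suc n) = [:0, 1:] * hermite s n - smult (of_real (2 * s * real n)) (hermite s (n - 1))"
proof -
  have "hermite s (Suc n) = heat_flow s ([:0, 1:] * monom 1 n)"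
    by (simp add: hermite_def monom_Suc)
  also have "pderiv (monom 1 n) = smult (of_nat n) (monom (1::complex) (n - 1))"
    by (simp add: pderiv_monom smult_monom)
  ultimately show ?thesis
    unfolding heat_flow_X_mult by (simp add: hermite_def heat_flow_smult)
qed

lemma poly_hermite_Suc:
  "poly (hermite s (Suc n)) x = x * poly (hermite s n) x - of_real (2 * s * real n) * poly (hermite s (n - 1)) x"
  by (simp add: hermite_Suc)

lemma poly_hermite_minus: "poly (hermite s n) (- x) = (- 1) ^ n * poly (hermite s n) x"
proof (induction n rule: induct_nat_012)
  case 1
  then show ?case by (simp add: poly_hermite_Suc)
next
  case (ge2 n)
  then show ?case by (simp add: poly_hermite_Suc[of s "Suc n"] algebra_simps)
qed simp

lemma higher_pderiv_hermite:
  "k \<le> n \<Longrightarrow> (pderiv ^^ k) (hermite s n) = smult (fact n / fact (n - k)) (hermite s (n - k))"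
proof (induction k)
  case (Suc k)
  obtain m where m: "n - k = Suc m" using Suc.prems by (metis Suc_diff_Suc Suc_le_lessD)
  have "pderiv (hermite s (Suc m)) = smult (of_nat (Suc m)) (hermite s m)"
    by (simp add: hermite_def pderiv_heat_flow pderiv_monom smult_monom flip: heat_flow_smult)
  then have "(pderiv ^^ Suc k) (hermite s n) = smult (fact n / fact (Suc m) * of_nat (Suc m)) (hermite s m)"
    using Suc m by (simp add: pderiv_smult)
  moreover have "fact n / fact (Suc m) * of_nat (Suc m) = (fact n / fact m :: complex)"
    using of_nat_neq_0[of m, where 'a=complex] by (simp add: divide_simps del: of_nat_Suc)
  moreover have "n - Suc k = m" using m by simp
  ultimately show ?case by simp
qed simp

lemma heat_flow_eq_hermite:
  assumes "degree p \<le> N"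
  shows "poly (heat_flow s p) z = (\<Sum>l\<le>N. coeff p l * poly (hermite s l) z)"
proof -
  have "p = (\<Sum>l\<le>N. monom (coeff p l) l)"
    using assms by (simp add: poly_as_sum_of_monoms')
  also have "\<dots> = (\<Sum>l\<le>N. smult (coeff p l) (monom 1 l))"
    by (simp add: smult_monom)
  finally have "heat_flow s p = (\<Sum>l\<le>N. smult (coeff p l) (hermite s l))"
    by (metis (no_types, lifting) heat_flow_smult heat_flow_sum hermite_def sum.cong)
  then show ?thesis by (simp add: poly_sum)
qed

section \<open>Taylor coefficients of shifted Hermite polynomials\<close>

lemma coeff_eq_higher_pderiv_0: "fact k * coeff p k = poly ((pderiv ^^ k) p) 0" for p :: "complex poly"
  by (simp add: poly_0_coeff_0 coeff_higher_pderiv pochhammer_fact)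

lemma higher_pderiv_shift:
  "(pderiv ^^ k) (pcompose p [:c, 1:]) = pcompose ((pderiv ^^ k) p) [:c, 1:]" for p :: "complex poly"
  by (induction k) (simp_all add: pderiv_pcompose pderiv_pCons)

text \<open>Appell property: the Taylor coefficients of the top Hermite polynomial at -z are
  multiples of the lower ones at -z, and parity turns -z into z. The factorials are the weights that
  appear in \<open>polarize_eq\<close>.\<close>

lemma hermite_shift_coeff:
  assumes "l \<le> N"
  shows "(- 1) ^ l * fact l * fact (N - l) * coeff (pcompose (hermite s N) [:- z, 1:]) (N - l)
    = fact N * poly (hermite s l) z"
proof -
  have "fact (N - l) * coeff (pcompose (hermite s N) [:- z, 1:]) (N - l)
      = fact N / fact l * ((- 1) ^ l * poly (hermite s l) z)"
    unfolding coeff_eq_higher_pderiv_0 higher_pderiv_shift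
    using assms by (simp add: higher_pderiv_hermite poly_pcompose poly_hermite_minus)
  then have "(- 1) ^ l * fact l * (fact (N - l) * coeff (pcompose (hermite s N) [:- z, 1:]) (N - l))
      = (- 1) ^ l * fact l * (fact N / fact l * ((- 1) ^ l * poly (hermite s l) z))" by simp
  also have "\<dots> = fact N * poly (hermite s l) z * ((- 1) ^ l * (- 1) ^ l)" by simp
  also have "(- 1) ^ l * (- 1) ^ l = (1 :: complex)"
    by (metis mult_1_left mult_minus_left minus_minus power_mult_distrib power_one)
  finally show ?thesis by (simp add: mult_ac)
qed

section \<open>Grace's theorem and the location of the zeros\<close>

text \<open>The polar derivative with pole b of a polynomial regarded as having degree k.\<close>

definition polar_deriv :: "nat \<Rightarrow> complex \<Rightarrow> complex poly \<Rightarrow> complex poly" where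
  "polar_deriv k b p = smult (of_nat k) p - [:- b, 1:] * pderiv p"

text \<open>Up to the factor \<open>N!\<close>, \<open>polarize bs p\<close> is the symmetric multiaffine form in the \<open>N\<close> entries of
  \<open>bs\<close> whose restriction to the diagonal is \<open>p\<close>.\<close>

fun polarize :: "complex list \<Rightarrow> complex poly \<Rightarrow> complex" where
  "polarize [] p = coeff p 0"
| "polarize (b # bs) p = polarize bs (polar_deriv (Suc (length bs)) b p)"

lemma coeff_polar_deriv:
  "coeff (polar_deriv k b p) l = (of_nat k - of_nat l) * coeff p l + b * of_nat (Suc l) * coeff p (Suc l)"
  by (cases l) (simp_all add: polar_deriv_def coeff_pderiv algebra_simps)

lemma degree_polar_deriv: "degree p \<le> Suc k \<Longrightarrow> degree (polar_deriv (Suc k) b p) \<le> k"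
proof (rule degree_le, intro allI impI)
  fix i assume "degree p \<le> Suc k" "k < i"
  then show "coeff (polar_deriv (Suc k) b p) i = 0"
    by (cases "i = Suc k") (simp_all add: coeff_polar_deriv coeff_eq_0)
qed

lemma degree_linear_prod_list: "degree (\<Prod>b\<leftarrow>bs. [:- b, 1 :: complex:]) = length bs"
proof (induction bs)
  case (Cons b bs)
  have "(\<Prod>b\<leftarrow>bs. [:- b, 1 :: complex:]) \<noteq> 0" by (auto simp: prod_list_zero_iff)
  then show ?case using Cons by (simp add: degree_mult_eq del: mult_pCons_left)
qed simp

text \<open>Iterated polar derivatives amount to the apolar pairing of p with the polynomial whose
  roots are the poles. A new pole multiplies that polynomial by a linear factor, whose two terms
  match the two terms of \<open>coeff_polar_deriv\<close>.\<close>

lemma polarize_eq: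
  assumes "degree p \<le> length bs"
  shows "polarize bs p = (\<Sum>l\<le>length bs. coeff p l * ((- 1) ^ l * fact l * fact (length bs - l)
    * coeff (\<Prod>b\<leftarrow>bs. [:- b, 1:]) (length bs - l)))"
  using assms
proof (induction bs arbitrary: p)
  case (Cons b bs)
  define k where "k = length bs"
  define q where "q = (\<Prod>b\<leftarrow>bs. [:- b, 1 :: complex:])"
  have qk: "coeff q (Suc k) = 0"
    using degree_linear_prod_list[of bs] by (intro coeff_eq_0) (simp add: q_def k_def)
  define A where "A = (\<lambda>l. coeff p l * ((- 1) ^ l * fact l * fact (Suc k - l) * coeff q (k - l)))"
  define B where "B = (\<lambda>l. b * coeff p l * ((- 1) ^ l * fact l * fact (Suc k - l) * coeff q (Suc k - l)))"
  have "polarize (b # bs) p = (\<Sum>l\<le>k. coeff (polar_deriv (Suc k) b p) l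
      * ((- 1) ^ l * fact l * fact (k - l) * coeff q (k - l)))"
    using Cons degree_polar_deriv[of p k b] by (simp add: k_def q_def)
  also have "\<dots> = (\<Sum>l\<le>k. A l - B (Suc l))"
  proof (rule sum.cong[OF refl])
    fix l assume "l \<in> {..k}"
    then have "Suc k - l = Suc (k - l)" "(of_nat k :: complex) = of_nat l + of_nat (k - l)" by (auto simp flip: of_nat_add)
    then show "coeff (polar_deriv (Suc k) b p) l * ((- 1) ^ l * fact l * fact (k - l) * coeff q (k - l))
        = A l - B (Suc l)"
      unfolding A_def B_def coeff_polar_deriv by (simp add: algebra_simps)
  qed
  also have "\<dots> = (\<Sum>l\<le>k. A l) - (\<Sum>l\<le>Suc k. B l)"
    unfolding sum_subtractf sum.atMost_Suc_shift[of B k] by (simp add: B_def qk)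
  \<comment> \<open>At l = Suc k the natural number \<open>k - l\<close> is 0, so \<open>A\<close>
    would add a spurious term; the constant coefficient of the product comes from \<open>B\<close>
    alone.\<close>
  also have "\<dots> = (\<Sum>l\<le>Suc k. (if l = Suc k then 0 else A l) - B l)"
    by (simp add: sum_subtractf)
  also have "\<dots> = (\<Sum>l\<le>Suc k. coeff p l * ((- 1) ^ l * fact l * fact (Suc k - l)
    * coeff ([:- b, 1:] * q) (Suc k - l)))"
  proof (rule sum.cong[OF refl])
    fix l assume "l \<in> {..Suc k}"
    then show "(if l = Suc k then 0 else A l) - B l = coeff p l * ((- 1) ^ l * fact l * fact (Suc k - l)
    * coeff ([:- b, 1:] * q) (Suc k - l))"
      by (auto simp: A_def B_def Suc_diff_le algebra_simps)
  qed
  finally show ?case by (simp add: k_def q_def del: mult_pCons_left)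
qed simp

text \<open>Taking the Hermite zeros translated by z as poles turns the value of the evolved
  polynomial at z into a multiaffine form, the shape to which Grace's theorem applies.\<close>

lemma hermite_polarize:
  assumes "degree p \<le> N"
  obtains bs where "length bs = N" "\<And>b. b \<in> set bs \<Longrightarrow> poly (hermite s N) (b - z) = 0"
    "polarize bs p = fact N * poly (heat_flow s p) z"
proof -
  define q where "q = pcompose (hermite s N) [:- z, 1:]"
  have dq: "degree q = N" by (simp add: q_def degree_pcompose)
  have lq: "lead_coeff q = 1"
    using lead_coeff_comp[of "[:- z, 1:]" "hermite s N"] by (simp add: q_def lead_coeff_hermite)
  obtain bs where bs: "mset bs = proots q" using ex_mset by blast
  have "q = (\<Prod>x\<in>#proots q. [:- x, 1:])"
    using complex_poly_decompose_multiset[of q] lq by simp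
  also have "\<dots> = (\<Prod>b\<leftarrow>bs. [:- b, 1:])"
    by (subst prod_mset_prod_list [symmetric]) (simp add: bs)
  finally have q: "q = (\<Prod>b\<leftarrow>bs. [:- b, 1:])" .
  have len: "length bs = N"
    using degree_linear_prod_list[of bs] dq q by simp
  show thesis
  proof
    show "length bs = N" by fact
    show "poly (hermite s N) (b - z) = 0" if "b \<in> set bs" for b
    proof -
      have "b \<in># proots q" using that by (simp flip: bs)
      then have "poly q b = 0" using dq by (cases "q = 0") auto
      then show ?thesis by (simp add: q_def poly_pcompose)
    qed
    have "polarize bs p = (\<Sum>l\<le>N. coeff p l * ((- 1) ^ l * fact l * fact (N - l) * coeff q (N - l)))"
      using polarize_eq[of p bs] assms len q by simp
    also have "\<dots> = (\<Sum>l\<le>N. coeff p l * (fact N * poly (hermite s l) z))"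
      by (intro sum.cong refl) (simp add: q_def hermite_shift_coeff)
    also have "\<dots> = fact N * poly (heat_flow s p) z"
      unfolding heat_flow_eq_hermite[OF assms] by (simp add: sum_distrib_left mult_ac)
    finally show "polarize bs p = fact N * poly (heat_flow s p) z" .
  qed
qed

section \<open>Logarithmic derivatives and Laguerre's theorem\<close>

lemma poly_pderiv_eq_sum_roots:
  fixes p :: "complex poly"
  assumes "poly p x \<noteq> 0"
  shows "poly (pderiv p) x = poly p x * (\<Sum>z | poly p z = 0. of_nat (order z p) / (x - z))"
proof -
  define Z where "Z = {z. poly p z = 0}"
  define f where "f = (\<lambda>z. [:- z, 1:] ^ order z p)"
  have nz: "x - z \<noteq> 0" if "z \<in> Z" for z using that assms by (auto simp: Z_def)
  have [simp]: "finite Z" using assms by (auto simp: Z_def intro!: poly_roots_finite)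
  have p: "p = smult (lead_coeff p) (prod f Z)"
    using complex_poly_decompose[of p] by (simp add: f_def Z_def)
  have f': "poly (prod f (Z - {z}) * pderiv (f z)) x = poly (prod f Z) x * (of_nat (order z p) / (x - z))" if "z \<in> Z" for z
  proof -
    have "order z p \<noteq> 0" using that assms by (auto simp: Z_def order_root)
    then obtain n where n: "order z p = Suc n" by (cases "order z p") auto
    have "prod f Z = f z * prod f (Z - {z})" using that by (intro prod.remove) auto
    moreover have "poly (pderiv (f z)) x = poly (f z) x * (of_nat (order z p) / (x - z))"
    proof -
      have "poly (pderiv (f z)) x = of_nat (Suc n) * (x - z) ^ n"
        unfolding f_def n pderiv_power_Suc by (simp add: pderiv_pCons)
      moreover have "poly (f z) x = (x - z) * (x - z) ^ n" by (simp add: f_def n algebra_simps)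
      ultimately show ?thesis using nz[OF that] by (simp only: n) simp
    qed
    ultimately show ?thesis by simp
  qed
  have "poly (pderiv p) x = lead_coeff p * (\<Sum>z\<in>Z. poly (prod f (Z - {z}) * pderiv (f z)) x)"
    by (subst p) (simp add: pderiv_smult pderiv_prod poly_sum)
  also have "\<dots> = lead_coeff p * poly (prod f Z) x * (\<Sum>z\<in>Z. of_nat (order z p) / (x - z))"
    by (simp only: sum_distrib_left f' mult.assoc cong: sum.cong)
  also have "lead_coeff p * poly (prod f Z) x = poly p x"
    using arg_cong[OF p, of "\<lambda>p. poly p x"] by simp
  finally show ?thesis by (simp add: Z_def)
qed

lemma sum_order_complex:
  fixes p :: "complex poly"
  assumes "p \<noteq> 0"
  shows "(\<Sum>z | poly p z = 0. order z p) = degree p"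
  using size_proots_complex[of p] assms by (simp add: size_multiset_overloaded_eq)

text \<open>Laguerre: inverting at a zero \<open>z\<close> of the polar derivative turns the exterior of the
  disc into a disc, hence a convex set, which contains the points \<open>1 / (z - r)\<close> for all
  roots \<open>r\<close> but not their average \<open>1 / (z - b)\<close>. Missing roots count as roots at infinity.\<close>

lemma polar_deriv_nonzero:
  assumes nz: "\<And>z. z \<in> ball c r \<Longrightarrow> poly p z \<noteq> 0"
    and deg: "degree p \<le> k" and k: "0 < k" and b: "b \<in> ball c r" and z: "z \<in> ball c r"
  shows "poly (polar_deriv k b p) z \<noteq> 0"
proof
  assume eq: "poly (polar_deriv k b p) z = 0"
  have pz: "poly p z \<noteq> 0" using nz z by blast
  define Z where "Z = {z. poly p z = 0}"
  define w where "w = (\<lambda>x. real (order x p))"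
  define S where "S = (\<Sum>x\<in>Z. of_real (w x) * (1 / (z - x)))"
  have "of_nat k * poly p z = (z - b) * poly (pderiv p) z"
    using eq by (simp add: polar_deriv_def algebra_simps)
  also have "\<dots> = (z - b) * S * poly p z"
    by (simp add: poly_pderiv_eq_sum_roots[OF pz] S_def Z_def w_def mult_ac)
  finally have kS: "of_nat k = (z - b) * S" using pz by simp
  then have zb: "z \<noteq> b" using k by auto
  define u where "u = 1 / (z - b)"
  have S: "S = of_nat k * u" using kS zb by (simp add: u_def)
  define A where "A = r\<^sup>2 - (cmod (z - c))\<^sup>2"
  have A: "0 < A"
  proof -
    have "cmod (z - c) < r" using z by (simp add: dist_norm norm_minus_commute)
    then show ?thesis unfolding A_def using power_strict_mono[of "cmod (z - c)" r 2] by simp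
  qed
  \<comment> \<open>With v = 1 / (z - x), the condition |x - c| >= r becomes F v <= 1, which
    describes a disc because A > 0.\<close>
  define F where "F = (\<lambda>x. A * (cmod x)\<^sup>2 + 2 * Re ((z - c) * x))"
  have F_eq: "F (1 / (z - x)) = 1 + (r\<^sup>2 - (cmod (x - c))\<^sup>2) / (cmod (z - x))\<^sup>2" if "z \<noteq> x" for x
  proof -
    define y where "y = z - x"
    have y: "y \<noteq> 0" using that by (simp add: y_def)
    define e where "e = Re ((z - c) * cnj y)"
    have "Re (w / y) = Re (w * cnj y) / (cmod y)\<^sup>2" for w
      by (subst complex_div_cnj) (simp only: Re_divide_of_real flip: of_real_power)
    then have re: "Re ((z - c) * (1 / y)) = e / (cmod y)\<^sup>2" by (simp add: e_def)
    have "x - c = (z - c) - y" by (simp add: y_def)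
    then have n: "(cmod (x - c))\<^sup>2 = (cmod (z - c))\<^sup>2 + (cmod y)\<^sup>2 - 2 * e"
      unfolding e_def by (simp only: cmod_power2) (simp add: power2_eq_square algebra_simps)
    have "F (1 / y) = 1 + (r\<^sup>2 - (cmod (x - c))\<^sup>2) / (cmod y)\<^sup>2"
      unfolding F_def re n A_def using y by (simp add: norm_divide power_divide field_simps)
    then show ?thesis by (simp add: y_def)
  qed
  have Fu: "1 < F u"
  proof -
    have "cmod (b - c) < r" using b by (simp add: dist_norm norm_minus_commute)
    then have "(cmod (b - c))\<^sup>2 < r\<^sup>2" by (intro power_strict_mono) auto
    then show ?thesis using zb by (simp add: u_def F_eq)
  qed
  have Fx: "F (1 / (z - x)) \<le> 1" if "x \<in> Z" for x
  proof -
    have "x \<notin> ball c r" using nz that by (auto simp: Z_def)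
    then have "r \<le> cmod (x - c)" by (simp add: dist_norm norm_minus_commute)
    moreover have "0 < r" using z by (metis le_less_trans mem_ball zero_le_dist)
    ultimately have "r\<^sup>2 \<le> (cmod (x - c))\<^sup>2" by (intro power_mono) auto
    moreover have "z \<noteq> x" using that pz by (auto simp: Z_def)
    ultimately show ?thesis by (simp add: F_eq divide_nonpos_nonneg)
  qed
  \<comment> \<open>Tangent plane of the convex quadratic F at u, from |x - u|^2 >= 0.\<close>
  have conv: "2 * A * Re (cnj u * x) - A * (cmod u)\<^sup>2 + 2 * Re ((z - c) * x) \<le> F x" for x
  proof -
    have "(cmod x)\<^sup>2 - 2 * Re (cnj u * x) + (cmod u)\<^sup>2 = (cmod (x - u))\<^sup>2"
      by (simp only: cmod_power2) (simp add: power2_eq_square algebra_simps)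
    then have "0 \<le> (cmod x)\<^sup>2 - 2 * Re (cnj u * x) + (cmod u)\<^sup>2" by simp
    then have "0 \<le> A * ((cmod x)\<^sup>2 - 2 * Re (cnj u * x) + (cmod u)\<^sup>2)" using A by simp
    then show ?thesis by (simp add: F_def algebra_simps)
  qed
  define W where "W = sum w Z"
  have "p \<noteq> 0" using pz by auto
  then have W: "W \<le> real k"
    using sum_order_complex[of p] pz deg by (auto simp: W_def w_def Z_def simp flip: of_nat_sum)
  have "real k * F u = 2 * A * Re (cnj u * S) - A * real k * (cmod u)\<^sup>2 + 2 * Re ((z - c) * S)"
    unfolding S F_def cmod_power2 by (simp add: power2_eq_square algebra_simps)
  \<comment> \<open>The k - W roots at infinity contribute nothing to S, and their tangent value -A
    |u|^2 is not positive.\<close>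
  also have "\<dots> \<le> 2 * A * Re (cnj u * S) - A * W * (cmod u)\<^sup>2 + 2 * Re ((z - c) * S)"
    using A W by (simp add: mult_left_mono mult_right_mono)
  also have "\<dots> = (\<Sum>x\<in>Z. w x * (2 * A * Re (cnj u * (1 / (z - x))) - A * (cmod u)\<^sup>2 + 2 * Re ((z - c) * (1 / (z - x)))))"
  proof -
    have "Re (v * S) = (\<Sum>x\<in>Z. w x * Re (v * (1 / (z - x))))" for v
    proof -
      have "Re (v * (complex_of_real c * y)) = c * Re (v * y)" for c y by (simp add: algebra_simps)
      then show ?thesis unfolding S_def by (simp only: sum_distrib_left Re_sum)
    qed
    then show ?thesis
      by (simp only: W_def sum_distrib_left sum_distrib_right sum.distrib sum_subtractf
          distrib_left right_diff_distrib) (simp add: mult_ac)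
  qed
  also have "\<dots> \<le> (\<Sum>x\<in>Z. w x * 1)"
    by (intro sum_mono mult_left_mono order_trans[OF conv Fx]) (auto simp: w_def)
  also have "\<dots> \<le> real k" using W by (simp add: W_def)
  finally have "real k * F u \<le> real k" .
  then show False using Fu k by (simp add: mult_le_cancel_left1)
qed

text \<open>Grace's theorem by induction over the poles: by Laguerre each polar derivative stays
  free of zeros on the disc, and it loses one formal degree, until a nonzero constant
  remains.\<close>

lemma polarize_nonzero:
  assumes "\<And>z. z \<in> ball c r \<Longrightarrow> poly p z \<noteq> 0" "degree p \<le> length bs" "set bs \<subseteq> ball c r"
    and "ball c r \<noteq> {}"
  shows "polarize bs p \<noteq> 0"
  using assms
proof (induction bs arbitrary: p)
  case Nil
  then obtain x where "x \<in> ball c r" by blast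
  moreover have "p = [:coeff p 0:]" using Nil by (auto elim!: degree_eq_zeroE)
  then have "poly p x = coeff p 0" by (metis poly_const_conv)
  ultimately show ?case using Nil by auto
next
  case (Cons b bs)
  then show ?case
    using polar_deriv_nonzero[of c r p "Suc (length bs)" b] degree_polar_deriv[of p "length bs" b] by auto
qed

text \<open>For x off the real axis, the ratio of consecutive values starts at x and evolves by R ->
  x - t / R with t >= 0. If R lies in the open half-plane of x, so does -1 / R; thus the ratio never
  leaves it and no value is 0.\<close>

lemma hermite_zero_real:
  assumes s: "0 \<le> s" and "poly (hermite s n) x = 0"
  shows "Im x = 0"
proof (rule ccontr)
  assume x: "Im x \<noteq> 0"
  have "poly (hermite s k) x \<noteq> 0 \<and> 0 \<le> Im x * Im (poly (hermite s (Suc k)) x / poly (hermite s k) x)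
    \<and> Im (poly (hermite s (Suc k)) x / poly (hermite s k) x) \<noteq> 0" for k
  proof (induction k)
    case 0
    then show ?case using x by (simp add: poly_hermite_Suc)
  next
    case (Suc k)
    define R where "R = poly (hermite s (Suc k)) x / poly (hermite s k) x"
    define t where "t = 2 * s * real (Suc k)"
    have R: "0 \<le> Im x * Im R" "Im R \<noteq> 0" using Suc by (auto simp: R_def)
    then have nz: "poly (hermite s (Suc k)) x \<noteq> 0" by (auto simp: R_def)
    have "poly (hermite s (Suc (Suc k))) x / poly (hermite s (Suc k)) x = x - of_real t / R"
      using nz Suc by (subst poly_hermite_Suc) (simp add: R_def t_def field_simps)
    moreover have "Im (x - of_real t / R) = Im x + t * Im R / (cmod R)\<^sup>2"
      by (simp add: Im_divide cmod_power2)
    moreover have "Im x * (Im x + t * Im R / (cmod R)\<^sup>2) = (Im x)\<^sup>2 + t * (Im x * Im R) / (cmod R)\<^sup>2"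
      by (simp add: power2_eq_square algebra_simps)
    moreover have "0 \<le> t" using s by (simp add: t_def)
    then have "0 < (Im x)\<^sup>2 + t * (Im x * Im R) / (cmod R)\<^sup>2"
      using x mult_nonneg_nonneg[OF \<open>0 \<le> t\<close> R(1)] by (intro add_pos_nonneg divide_nonneg_nonneg) auto
    ultimately show ?case using nz by (metis less_imp_le less_numeral_extra(3) mult_zero_right)
  qed
  then show False using assms by blast
qed

text \<open>The map R -> |x| - \<tau>^2 / R sends [|x| / 2, infinity) into itself as soon as |x| >=
  2 \<tau>, with |x| / 2 as fixed point in the extreme case. So ratios of consecutive values keep
  modulus at least |x| / 2; this is the origin of the constant 2 \<tau>.\<close>

lemma hermite_zero_bound:
  assumes s: "0 \<le> s" "2 * s * real n \<le> \<tau>\<^sup>2" "0 \<le> \<tau>" and "poly (hermite s n) x = 0"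
  shows "cmod x \<le> 2 * \<tau>"
proof (rule ccontr)
  assume "\<not> cmod x \<le> 2 * \<tau>"
  then have x: "2 * \<tau> < cmod x" by simp
  then have x0: "0 < cmod x" using s by linarith
  have "poly (hermite s k) x \<noteq> 0 \<and>
    (k < n \<longrightarrow> cmod x / 2 * cmod (poly (hermite s k) x) \<le> cmod (poly (hermite s (Suc k)) x))" if "k \<le> n" for k
    using that
  proof (induction k)
    case 0
    then show ?case by (simp add: poly_hermite_Suc)
  next
    case (Suc k)
    define h where "h = (\<lambda>k. cmod (poly (hermite s k) x))"
    have h: "0 < h k" "cmod x / 2 * h k \<le> h (Suc k)" using Suc by (auto simp: h_def)
    moreover have "0 < cmod x / 2 * h k" using h x0 by simp
    ultimately have nz: "0 < h (Suc k)" by linarith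
    have "cmod x / 2 * h (Suc k) \<le> h (Suc (Suc k))" if "Suc k < n"
    proof -
      define t where "t = 2 * s * real (Suc k)"
      have "t \<le> 2 * s * real n" unfolding t_def using s that by (intro mult_left_mono) auto
      then have t: "t \<le> \<tau>\<^sup>2" "0 \<le> t" using s by (auto simp: t_def)
      have "\<tau>\<^sup>2 \<le> (cmod x / 2)\<^sup>2" using x s by (intro power_mono) auto
      then have "t * h k \<le> (cmod x / 2)\<^sup>2 * h k" using t h by (intro mult_right_mono) auto
      also have "\<dots> = cmod x / 2 * (cmod x / 2 * h k)" by (simp add: power2_eq_square)
      also have "\<dots> \<le> cmod x / 2 * h (Suc k)" using h x0 by (intro mult_left_mono) auto
      finally have 1: "t * h k \<le> cmod x / 2 * h (Suc k)" .
      have "cmod (x * poly (hermite s (Suc k)) x) - cmod (of_real t * poly (hermite s k) x) \<le> h (Suc (Suc k))"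
        unfolding h_def poly_hermite_Suc[of s "Suc k"] t_def diff_Suc_1 by (rule norm_triangle_ineq2)
      then have "cmod x * h (Suc k) - t * h k \<le> h (Suc (Suc k))"
        using t by (simp add: h_def norm_mult)
      then show ?thesis using 1 by (simp add: field_simps)
    qed
    then show ?case using nz by (auto simp: h_def)
  qed
  then show False using assms by blast
qed

text \<open>The time is scaled such that 2 s N = \<tau>^2, so the poles from
  \<open>hermite_polarize\<close> lie on the segment of half-length 2 \<tau> around z, hence in the
  disc, and Grace's theorem applies.\<close>

lemma heat_flow_nonzero:
  assumes N: "degree q \<le> N" "0 < N" and \<tau>: "0 \<le> \<tau>"
    and seg: "\<And>x. \<bar>x\<bar> \<le> 2 * \<tau> \<Longrightarrow> z + of_real x \<in> ball c r"
    and nz: "\<And>y. y \<in> ball c r \<Longrightarrow> poly q y \<noteq> 0"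
  shows "poly (heat_flow (\<tau>\<^sup>2 / (2 * real N)) q) z \<noteq> 0"
proof -
  define s where "s = \<tau>\<^sup>2 / (2 * real N)"
  have s: "0 \<le> s" "2 * s * real N \<le> \<tau>\<^sup>2" using N by (auto simp: s_def)
  obtain bs where bs: "length bs = N" "\<And>b. b \<in> set bs \<Longrightarrow> poly (hermite s N) (b - z) = 0"
    "polarize bs q = fact N * poly (heat_flow s q) z"
    using hermite_polarize[OF N(1)] by metis
  have "set bs \<subseteq> ball c r"
  proof
    fix b assume "b \<in> set bs"
    then have 0: "poly (hermite s N) (b - z) = 0" by (rule bs)
    have "cmod (b - z) \<le> 2 * \<tau>" using hermite_zero_bound[OF s \<tau> 0] .
    moreover have "b - z = of_real (Re (b - z))"
      using hermite_zero_real[OF s(1) 0] by (simp add: complex_eq_iff)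
    ultimately have "\<bar>Re (b - z)\<bar> \<le> 2 * \<tau>" "b = z + of_real (Re (b - z))"
      by (metis norm_of_real, metis diff_add_cancel add.commute)
    then show "b \<in> ball c r" using seg by metis
  qed
  moreover have "ball c r \<noteq> {}" using seg[of 0] \<tau> by fastforce
  ultimately have "polarize bs q \<noteq> 0"
    using polarize_nonzero[of c r q bs] nz N(1) bs(1) by blast
  then show ?thesis using bs by (auto simp: s_def)
qed

lemma heat_flow_zero_near:
  assumes "degree q \<le> N" "0 < N" "0 \<le> \<tau>" "poly (heat_flow (\<tau>\<^sup>2 / (2 * real N)) q) z = 0" "q \<noteq> 0"
  obtains l where "poly q l = 0" "cmod (z - l) \<le> 2 * \<tau>"
proof -
  define Z where "Z = {l. poly q l = 0}"
  have [simp]: "finite Z" using assms by (simp add: Z_def poly_roots_finite)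
  have "\<exists>l\<in>Z. cmod (z - l) \<le> 2 * \<tau>"
  proof (rule ccontr)
    assume no: "\<not> ?thesis"
    \<comment> \<open>The distance to the nearest root works as radius: it exceeds 2 \<tau>
      strictly, so the closed segment fits in, while the open disc misses all roots.\<close>
    have "\<exists>r > 2 * \<tau>. \<forall>l\<in>Z. r \<le> cmod (z - l)"
    proof (cases "Z = {}")
      case True
      then show ?thesis using gt_ex by auto
    next
      case False
      then have "Min ((\<lambda>l. cmod (z - l)) ` Z) \<in> (\<lambda>l. cmod (z - l)) ` Z" by (intro Min_in) auto
      then show ?thesis using no by (intro exI[of _ "Min ((\<lambda>l. cmod (z - l)) ` Z)"]) auto
    qed
    then obtain r where r: "r > 2 * \<tau>" "\<And>l. l \<in> Z \<Longrightarrow> r \<le> cmod (z - l)" by blast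
    have "poly (heat_flow (\<tau>\<^sup>2 / (2 * real N)) q) z \<noteq> 0"
      by (rule heat_flow_nonzero[of _ _ _ _ z r]) (use assms r in \<open>force simp: dist_norm Z_def\<close>)+
    then show False using assms by simp
  qed
  then show thesis using that by (auto simp: Z_def)
qed

text \<open>The test disc has \<open>[z - 2 \<tau>, z + 2 \<tau>]\<close> as a chord close to its boundary.\<close>

lemma heat_flow_zero_Im:
  assumes q: "degree q \<le> N" "0 < N" "q \<noteq> 0" and \<tau>: "0 \<le> \<tau>" "\<tau> \<le> \<sigma> / 8" and \<sigma>: "0 < \<sigma>"
    and sep: "\<And>y. poly q y = 0 \<Longrightarrow> y \<noteq> l \<Longrightarrow> \<sigma> \<le> cmod (y - l)"
    and z: "poly (heat_flow (\<tau>\<^sup>2 / (2 * real N)) q) z = 0" "cmod (z - l) \<le> 2 * \<tau>"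
  shows "\<bar>Im (z - l)\<bar> \<le> 8 * \<tau>\<^sup>2 / \<sigma>"
proof -
  have main: "e * Im (z - l) \<le> 8 * \<tau>\<^sup>2 / \<sigma>" if e: "e = 1 \<or> e = - 1" for e :: real
  proof (rule ccontr)
    assume no: "\<not> ?thesis"
    have e2: "e * e = 1" using e by auto
    \<comment> \<open>The centre lies \<sigma> / 4 beyond z on the side to which z deviates, and l
      lies on the boundary. The diameter is at most \<sigma>, so no other root fits in; a deviation
      above the claimed bound leaves room for the whole chord.\<close>
    define c where "c = z + of_real (e * \<sigma> / 4) * \<i>"
    define R where "R = cmod (c - l)"
    have "R\<^sup>2 = (cmod (z - l))\<^sup>2 + (\<sigma> / 4)\<^sup>2 * (e * e) + \<sigma> / 2 * (e * Im (z - l))"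
      unfolding R_def c_def cmod_power2 by (simp add: power2_eq_square algebra_simps)
    then have "R\<^sup>2 \<ge> (\<sigma> / 4)\<^sup>2 + \<sigma> / 2 * (e * Im (z - l))" by (simp add: e2)
    moreover have "\<sigma> / 2 * (e * Im (z - l)) > 4 * \<tau>\<^sup>2"
      using no \<sigma> by (simp add: field_simps)
    ultimately have R: "R\<^sup>2 > (\<sigma> / 4)\<^sup>2 + (2 * \<tau>)\<^sup>2" by (simp add: power_mult_distrib)
    have "R \<le> cmod (z - l) + \<sigma> / 4"
      unfolding R_def c_def using e \<sigma> norm_triangle_ineq[of "z - l" "of_real (e * \<sigma> / 4) * \<i>"]
      by (auto simp: norm_mult algebra_simps)
    then have R': "R \<le> \<sigma> / 2" using z \<tau> by simp
    have "poly (heat_flow (\<tau>\<^sup>2 / (2 * real N)) q) z \<noteq> 0"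
    proof (rule heat_flow_nonzero[OF q(1,2) \<tau>(1)])
      fix x :: real assume "\<bar>x\<bar> \<le> 2 * \<tau>"
      then have "x\<^sup>2 \<le> (2 * \<tau>)\<^sup>2" by (metis abs_ge_zero power2_abs power_mono)
      have "(cmod (c - (z + of_real x)))\<^sup>2 = x\<^sup>2 + (\<sigma> / 4)\<^sup>2 * (e * e)"
        unfolding c_def cmod_power2 by (simp add: power2_eq_square)
      also have "\<dots> < R\<^sup>2" using R \<open>x\<^sup>2 \<le> (2 * \<tau>)\<^sup>2\<close> by (simp add: e2)
      finally have "cmod (c - (z + of_real x)) < R"
        by (rule power2_less_imp_less) (simp add: R_def)
      then show "z + of_real x \<in> ball c R" by (simp add: dist_norm)
    next
      fix y assume y: "y \<in> ball c R"
      show "poly q y \<noteq> 0"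
      proof
        assume y0: "poly q y = 0"
        have "y \<noteq> l" using y by (auto simp: R_def dist_norm)
        then have "\<sigma> \<le> cmod (y - l)" using sep y0 by blast
        also have "\<dots> \<le> cmod (y - c) + cmod (c - l)" using norm_triangle_ineq[of "y - c" "c - l"] by simp
        also have "\<dots> < R + R" using y by (simp add: dist_norm norm_minus_commute R_def)
        finally show False using R' by simp
      qed
    qed
    then show False using z by simp
  qed
  show ?thesis using main[of 1] main[of "-1"] by (auto simp: abs_le_iff)
qed

section \<open>Power sums over a cluster of zeros\<close>

definition near_sum :: "complex poly \<Rightarrow> complex \<Rightarrow> real \<Rightarrow> nat \<Rightarrow> complex" where
  "near_sum p l r k = (\<Sum>z | poly p z = 0 \<and> cmod (z - l) < r. of_nat (order z p) * (z - l) ^ k)"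

section \<open>Cauchy integrals with one and two poles\<close>

lemma contour_cauchy_power:
  assumes "0 < r" "cmod (a - l) \<noteq> r"
  shows "((\<lambda>z. (z - l) ^ k / (z - a)) has_contour_integral
    2 * pi * \<i> * (if cmod (a - l) < r then (a - l) ^ k else 0)) (circlepath l r)"
proof (cases "cmod (a - l) < r")
  case True
  then show ?thesis
    using Cauchy_integral_circlepath_simple[of "\<lambda>z. (z - l) ^ k" l r a]
    by (simp add: holomorphic_on_power holomorphic_on_diff)
next
  case False
  have "((\<lambda>z. (z - l) ^ k / (z - a)) has_contour_integral 0) (circlepath l r)"
  proof (rule Cauchy_theorem_convex_simple[where S = "cball l r"])
    show "(\<lambda>z. (z - l) ^ k / (z - a)) holomorphic_on cball l r"
      using False assms by (intro holomorphic_intros) (auto simp: dist_norm norm_minus_commute)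
  qed (use assms in \<open>auto simp: sphere_def\<close>)
  then show ?thesis using False by simp
qed

lemma contour_cauchy_near_near_0:
  assumes "0 < r" "cmod (a - l) < r" "cmod (b - l) < r"
  shows "((\<lambda>z. 1 / ((z - a) * (z - b))) has_contour_integral 0) (circlepath l r)"
proof (cases "a = b")
  case True
  have "((\<lambda>z. 1 / ((z - a) * (z - a))) has_contour_integral 0) (circlepath l r)"
  proof (rule Cauchy_theorem_primitive[where f = "\<lambda>z. - 1 / (z - a)" and S = "- {a}"])
    show "((\<lambda>z. - 1 / (z - a)) has_field_derivative 1 / ((x - a) * (x - a))) (at x within - {a})"
      if "x \<in> - {a}" for x
      using that by (auto intro!: derivative_eq_intros)
    show "path_image (circlepath l r) \<subseteq> - {a}" using assms by (auto simp: dist_norm norm_minus_commute)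
  qed auto
  then show ?thesis using True by simp
next
  case False
  have "((\<lambda>z. (1 / (a - b)) * ((z - l) ^ 0 / (z - a) - (z - l) ^ 0 / (z - b))) has_contour_integral
      (1 / (a - b)) * (2 * pi * \<i> * 1 - 2 * pi * \<i> * 1)) (circlepath l r)"
    using contour_cauchy_power[of r a l 0] contour_cauchy_power[of r b l 0] assms
    by (intro has_contour_integral_lmul has_contour_integral_diff) auto
  then have "((\<lambda>z. 1 / ((z - a) * (z - b))) has_contour_integral
      (1 / (a - b)) * (2 * pi * \<i> * 1 - 2 * pi * \<i> * 1)) (circlepath l r)"
  proof (rule has_contour_integral_eq)
    fix z assume "z \<in> path_image (circlepath l r)"
    then have "z \<noteq> a" "z \<noteq> b" using assms by (auto simp: dist_norm norm_minus_commute)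
    then show "1 / (a - b) * ((z - l) ^ 0 / (z - a) - (z - l) ^ 0 / (z - b)) = 1 / ((z - a) * (z - b))"
      using False by (simp add: divide_simps)
  qed
  then show ?thesis by simp
qed

text \<open>Induction by z - l = (z - a) + (a - l). The sum is the divided difference of w^k at a -
  l and b - l, written without division so that it covers a = b.\<close>

lemma contour_cauchy_near_near:
  assumes "0 < r" "cmod (a - l) < r" "cmod (b - l) < r"
  shows "((\<lambda>z. (z - l) ^ k / ((z - a) * (z - b))) has_contour_integral
    2 * pi * \<i> * (\<Sum>i<k. (a - l) ^ i * (b - l) ^ (k - 1 - i))) (circlepath l r)"
proof (induction k)
  case 0
  then show ?case using contour_cauchy_near_near_0[OF assms] by simp
next
  case (Suc k)
  have "((\<lambda>z. (z - l) ^ k / (z - b) + (a - l) * ((z - l) ^ k / ((z - a) * (z - b)))) has_contour_integral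
      2 * pi * \<i> * (b - l) ^ k + (a - l) * (2 * pi * \<i> * (\<Sum>i<k. (a - l) ^ i * (b - l) ^ (k - 1 - i))))
      (circlepath l r)"
    using contour_cauchy_power[of r b l k] assms Suc
    by (intro has_contour_integral_lmul has_contour_integral_add) auto
  also have "2 * pi * \<i> * (b - l) ^ k + (a - l) * (2 * pi * \<i> * (\<Sum>i<k. (a - l) ^ i * (b - l) ^ (k - 1 - i)))
     = 2 * pi * \<i> * (\<Sum>i<Suc k. (a - l) ^ i * (b - l) ^ (Suc k - 1 - i))"
    by (subst sum.lessThan_Suc_shift) (simp add: sum_distrib_left algebra_simps)
  finally show ?case
  proof (rule has_contour_integral_eq)
    fix z assume "z \<in> path_image (circlepath l r)"
    then have "z \<noteq> a" "z \<noteq> b" using assms by (auto simp: dist_norm norm_minus_commute)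
    then show "(z - l) ^ k / (z - b) + (a - l) * ((z - l) ^ k / ((z - a) * (z - b)))
      = (z - l) ^ Suc k / ((z - a) * (z - b))"
      by (simp add: divide_simps) (simp add: algebra_simps)
  qed
qed

lemma contour_cauchy_near_far:
  assumes "0 < r" "cmod (a - l) < r" "r < cmod (b - l)"
  shows "((\<lambda>z. (z - l) ^ k / ((z - a) * (z - b))) has_contour_integral
    2 * pi * \<i> * ((a - l) ^ k / (a - b))) (circlepath l r)"
proof -
  have "((\<lambda>z. (1 / (a - b)) * ((z - l) ^ k / (z - a) - (z - l) ^ k / (z - b))) has_contour_integral
      (1 / (a - b)) * (2 * pi * \<i> * (a - l) ^ k - 0)) (circlepath l r)"
    using contour_cauchy_power[of r a l k] contour_cauchy_power[of r b l k] assms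
    by (intro has_contour_integral_lmul has_contour_integral_diff) auto
  then have "((\<lambda>z. (z - l) ^ k / ((z - a) * (z - b))) has_contour_integral
      (1 / (a - b)) * (2 * pi * \<i> * (a - l) ^ k - 0)) (circlepath l r)"
  proof (rule has_contour_integral_eq)
    fix z assume "z \<in> path_image (circlepath l r)"
    then have "z \<noteq> a" "z \<noteq> b" "a \<noteq> b" using assms by (auto simp: dist_norm norm_minus_commute)
    then show "1 / (a - b) * ((z - l) ^ k / (z - a) - (z - l) ^ k / (z - b)) = (z - l) ^ k / ((z - a) * (z - b))"
      by (simp add: divide_simps) (simp add: algebra_simps)
  qed
  then show ?thesis by simp
qed

lemma contour_cauchy_far_far:
  assumes "0 < r" "r < cmod (a - l)" "r < cmod (b - l)"
  shows "((\<lambda>z. (z - l) ^ k / ((z - a) * (z - b))) has_contour_integral 0) (circlepath l r)"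
proof (rule Cauchy_theorem_convex_simple[where S = "cball l r"])
  show "(\<lambda>z. (z - l) ^ k / ((z - a) * (z - b))) holomorphic_on cball l r"
    using assms by (intro holomorphic_intros) (auto simp: dist_norm norm_minus_commute)
qed (use assms in \<open>auto simp: sphere_def\<close>)

text \<open>Differentiating p' = p S gives p'' = p (S^2 + S'). Writing this as all pairs minus a
  diagonal, with orders as weights, covers multiple zeros without a case distinction.\<close>

lemma poly_pderiv2_eq_sum_roots:
  fixes p :: "complex poly"
  assumes "poly p x \<noteq> 0"
  shows "poly (pderiv (pderiv p)) x = poly p x *
    ((\<Sum>(a, b)\<in>{z. poly p z = 0} \<times> {z. poly p z = 0}. of_nat (order a p) * of_nat (order b p) / ((x - a) * (x - b)))
     - (\<Sum>z | poly p z = 0. of_nat (order z p) / ((x - z) * (x - z))))"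
proof -
  define Z where "Z = {z. poly p z = 0}"
  define S where "S = (\<lambda>x. \<Sum>z\<in>Z. of_nat (order z p) / (x - z))"
  define U where "U = {x. poly p x \<noteq> 0}"
  have "open U" unfolding U_def by (intro open_Collect_neq continuous_intros)
  have xU: "x \<in> U" using assms by (simp add: U_def)
  have [simp]: "finite Z" using assms by (auto simp: Z_def intro!: poly_roots_finite)
  have dS: "(S has_field_derivative - (\<Sum>z\<in>Z. of_nat (order z p) / ((x - z) * (x - z)))) (at x)"
    unfolding S_def sum_negf[symmetric]
  proof (rule DERIV_sum)
    fix z assume "z \<in> Z"
    then have "x \<noteq> z" using assms by (auto simp: Z_def)
    then show "((\<lambda>x. of_nat (order z p) / (x - z)) has_field_derivative
        - (of_nat (order z p) / ((x - z) * (x - z)))) (at x)"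
      by (auto intro!: derivative_eq_intros)
  qed
  have "((\<lambda>x. poly p x * S x) has_field_derivative
      poly (pderiv p) x * S x - poly p x * (\<Sum>z\<in>Z. of_nat (order z p) / ((x - z) * (x - z)))) (at x)"
    using DERIV_mult[OF poly_DERIV dS] by (simp add: algebra_simps)
  moreover have "poly p y * S y = poly (pderiv p) y" if "y \<in> U" for y
    using poly_pderiv_eq_sum_roots[of p y] that by (simp add: U_def S_def Z_def)
  ultimately have "((\<lambda>x. poly (pderiv p) x) has_field_derivative
      poly (pderiv p) x * S x - poly p x * (\<Sum>z\<in>Z. of_nat (order z p) / ((x - z) * (x - z)))) (at x)"
    using \<open>open U\<close> xU by (auto intro: has_field_derivative_transform_within_open)
  then have "poly (pderiv (pderiv p)) x =
      poly (pderiv p) x * S x - poly p x * (\<Sum>z\<in>Z. of_nat (order z p) / ((x - z) * (x - z)))"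
    by (rule DERIV_unique[OF poly_DERIV])
  also have "poly (pderiv p) x = poly p x * S x"
    using poly_pderiv_eq_sum_roots[OF assms] by (simp add: S_def Z_def)
  also have "S x * S x = (\<Sum>(a, b)\<in>Z \<times> Z. of_nat (order a p) * of_nat (order b p) / ((x - a) * (x - b)))"
    unfolding S_def sum_product sum.cartesian_product by simp
  then have "poly p x * S x * S x = poly p x * (\<Sum>(a, b)\<in>Z \<times> Z. of_nat (order a p) * of_nat (order b p) / ((x - a) * (x - b)))"
    by (simp add: mult.assoc)
  finally show ?thesis by (simp add: Z_def right_diff_distrib)
qed

lemma contour_near_sum:
  assumes r: "0 < r" and nz: "\<And>z. z \<in> sphere l r \<Longrightarrow> poly p z \<noteq> 0"
  shows "((\<lambda>z. (z - l) ^ k * (poly (pderiv p) z / poly p z)) has_contour_integral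
    2 * pi * \<i> * near_sum p l r k) (circlepath l r)"
proof -
  define Z where "Z = {z. poly p z = 0}"
  have "poly p (l + of_real r) \<noteq> 0" using nz r by (simp add: dist_norm)
  then have [simp]: "finite Z" by (auto simp: Z_def intro!: poly_roots_finite)
  have far: "cmod (a - l) \<noteq> r" if "a \<in> Z" for a
    using nz[of a] that by (auto simp: Z_def dist_norm norm_minus_commute)
  have "((\<lambda>z. \<Sum>a\<in>Z. of_nat (order a p) * ((z - l) ^ k / (z - a))) has_contour_integral
     (\<Sum>a\<in>Z. of_nat (order a p) * (2 * pi * \<i> * (if cmod (a - l) < r then (a - l) ^ k else 0)))) (circlepath l r)"
    using contour_cauchy_power[OF r far]
    by (intro has_contour_integral_sum has_contour_integral_lmul) auto
  also have "(\<Sum>a\<in>Z. of_nat (order a p) * (2 * pi * \<i> * (if cmod (a - l) < r then (a - l) ^ k else 0)))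
     = (\<Sum>a\<in>Z. if cmod (a - l) < r then 2 * pi * \<i> * (of_nat (order a p) * (a - l) ^ k) else 0)"
    by (intro sum.cong) (auto simp: mult_ac)
  also have "\<dots> = 2 * pi * \<i> * near_sum p l r k"
    by (subst sum.inter_filter[OF \<open>finite Z\<close>, symmetric]) (simp add: near_sum_def Z_def sum_distrib_left)
  finally show ?thesis
  proof (rule has_contour_integral_eq)
    fix z assume "z \<in> path_image (circlepath l r)"
    then have "poly p z \<noteq> 0" using nz r by simp
    then show "(\<Sum>a\<in>Z. of_nat (order a p) * ((z - l) ^ k / (z - a))) = (z - l) ^ k * (poly (pderiv p) z / poly p z)"
    proof -
      have "poly (pderiv p) z / poly p z = (\<Sum>a\<in>Z. of_nat (order a p) / (z - a))"
        using \<open>poly p z \<noteq> 0\<close> poly_pderiv_eq_sum_roots[of p z] by (simp add: Z_def)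
      then show ?thesis by (simp add: sum_distrib_left mult_ac)
    qed
  qed
qed

text \<open>The interaction of the cluster with the other zeros: forces 1 / (a - b) weighted by (a -
  l)^k.\<close>

definition near_far_sum :: "complex poly \<Rightarrow> complex \<Rightarrow> real \<Rightarrow> nat \<Rightarrow> complex" where
  "near_far_sum p l r k = (\<Sum>a | poly p a = 0 \<and> cmod (a - l) < r. \<Sum>b | poly p b = 0 \<and> \<not> cmod (b - l) < r.
     of_nat (order a p) * of_nat (order b p) * ((a - l) ^ k / (a - b)))"

text \<open>Residues by pairs of zeros: two inside give divided differences, hence the convolution
  of power sums; mixed pairs occur in both orders, hence the factor 2; two outside give nothing. The
  subtracted diagonal gives the term with k - 1.\<close>

lemma contour_near_sum2:
  assumes r: "0 < r" and nz: "\<And>z. z \<in> sphere l r \<Longrightarrow> poly p z \<noteq> 0"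
  shows "((\<lambda>z. (z - l) ^ k * (poly (pderiv (pderiv p)) z / poly p z)) has_contour_integral
    2 * pi * \<i> * ((\<Sum>i<k. near_sum p l r i * near_sum p l r (k - 1 - i)) - of_nat k * near_sum p l r (k - 1)
      + 2 * near_far_sum p l r k)) (circlepath l r)"
proof -
  define Z where "Z = {z. poly p z = 0}"
  define A where "A = {z \<in> Z. cmod (z - l) < r}"
  define B where "B = {z \<in> Z. \<not> cmod (z - l) < r}"
  define w where "w = (\<lambda>a. of_nat (order a p) :: complex)"
  define C where "C = (\<lambda>a b. if a \<in> A then if b \<in> A then \<Sum>i<k. (a - l) ^ i * (b - l) ^ (k - 1 - i) else (a - l) ^ k / (a - b)
    else if b \<in> A then (b - l) ^ k / (b - a) else 0)"
  have "poly p (l + of_real r) \<noteq> 0" using nz r by (simp add: dist_norm)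
  then have [simp]: "finite Z" by (auto simp: Z_def intro!: poly_roots_finite)
  have [simp]: "finite A" "finite B" by (simp_all add: A_def B_def)
  have Z: "Z = A \<union> B" "A \<inter> B = {}" by (auto simp: A_def B_def)
  have AB: "{z. poly p z = 0 \<and> cmod (z - l) < r} = A" "{z. poly p z = 0 \<and> \<not> cmod (z - l) < r} = B"
    by (auto simp: A_def B_def Z_def)
  have ns: "near_sum p l r k = (\<Sum>a\<in>A. w a * (a - l) ^ k)" for k
    by (simp add: near_sum_def AB w_def)
  have CAB: "C a b = (a - l) ^ k / (a - b)" "C b a = (a - l) ^ k / (a - b)" if "a \<in> A" "b \<in> B" for a b
    using that Z(2) by (auto simp: C_def)
  have nearA: "cmod (a - l) < r" if "a \<in> A" for a
    using that by (simp add: A_def)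
  have farB: "r < cmod (b - l)" if "b \<in> B" for b
  proof -
    have "b \<notin> sphere l r" using that nz by (auto simp: B_def Z_def)
    then show ?thesis using that by (simp add: B_def dist_norm norm_minus_commute)
  qed
  have C: "((\<lambda>z. (z - l) ^ k / ((z - a) * (z - b))) has_contour_integral 2 * pi * \<i> * C a b) (circlepath l r)"
    if "a \<in> Z" "b \<in> Z" for a b
  proof -
    have "a \<in> A \<or> a \<in> B" "b \<in> A \<or> b \<in> B" using that by (auto simp: Z(1))
    then consider "a \<in> A" "b \<in> A" | "a \<in> A" "b \<in> B" | "a \<in> B" "b \<in> A" | "a \<in> B" "b \<in> B"
      by blast
    then show ?thesis
    proof cases
      case 1
      then have "C a b = (\<Sum>i<k. (a - l) ^ i * (b - l) ^ (k - 1 - i))" by (simp add: C_def)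
      then show ?thesis using contour_cauchy_near_near[OF r nearA[OF 1(1)] nearA[OF 1(2)]] by simp
    next
      case 2
      show ?thesis
        using contour_cauchy_near_far[OF r nearA[OF 2(1)] farB[OF 2(2)], of k] by (simp only: CAB(1)[OF 2])
    next
      case 3
      have "(z - l) ^ k / ((z - a) * (z - b)) = (z - l) ^ k / ((z - b) * (z - a))" for z
        by (simp only: mult.commute)
      then show ?thesis
        using contour_cauchy_near_far[OF r nearA[OF 3(2)] farB[OF 3(1)], of k]
        by (simp only: CAB(2)[OF 3(2,1)])
    next
      case 4
      then have "C a b = 0" using Z(2) by (auto simp: C_def)
      then show ?thesis using contour_cauchy_far_far[OF r farB[OF 4(1)] farB[OF 4(2)]] by simp
    qed
  qed
  have alg: "x + y + (y + 0) - v = x - v + 2 * y" for x y v :: complex by simp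
  have "((\<lambda>z. (\<Sum>(a, b)\<in>Z \<times> Z. w a * w b * ((z - l) ^ k / ((z - a) * (z - b))))
        - (\<Sum>a\<in>Z. w a * ((z - l) ^ k / ((z - a) * (z - a))))) has_contour_integral
     ((\<Sum>(a, b)\<in>Z \<times> Z. w a * w b * (2 * pi * \<i> * C a b)) - (\<Sum>a\<in>Z. w a * (2 * pi * \<i> * C a a)))) (circlepath l r)"
    unfolding case_prod_unfold
    by (intro has_contour_integral_sum has_contour_integral_diff has_contour_integral_lmul C) auto
  also have "(\<Sum>(a, b)\<in>Z \<times> Z. w a * w b * (2 * pi * \<i> * C a b)) - (\<Sum>a\<in>Z. w a * (2 * pi * \<i> * C a a))
    = 2 * pi * \<i> * ((\<Sum>(a, b)\<in>Z \<times> Z. w a * w b * C a b) - (\<Sum>a\<in>Z. w a * C a a))"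
    by (simp add: sum_distrib_left right_diff_distrib case_prod_unfold mult_ac)
  also have "(\<Sum>(a, b)\<in>Z \<times> Z. w a * w b * C a b) = (\<Sum>a\<in>Z. \<Sum>b\<in>Z. w a * w b * C a b)"
    by (rule sum.cartesian_product[symmetric])
  also have "\<dots> = (\<Sum>a\<in>A. \<Sum>b\<in>A. w a * w b * C a b) + (\<Sum>a\<in>A. \<Sum>b\<in>B. w a * w b * C a b)
      + ((\<Sum>a\<in>B. \<Sum>b\<in>A. w a * w b * C a b) + (\<Sum>a\<in>B. \<Sum>b\<in>B. w a * w b * C a b))"
    unfolding Z(1) using Z(2) by (simp add: sum.union_disjoint sum.distrib)
  also have "(\<Sum>a\<in>B. \<Sum>b\<in>B. w a * w b * C a b) = 0"
    using Z(2) by (intro sum.neutral ballI) (auto simp: C_def)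
  also have "(\<Sum>a\<in>B. \<Sum>b\<in>A. w a * w b * C a b) = (\<Sum>b\<in>A. \<Sum>a\<in>B. w a * w b * C a b)"
    by (rule sum.swap)
  also have "\<dots> = (\<Sum>a\<in>A. \<Sum>b\<in>B. w a * w b * C a b)"
    by (intro sum.cong refl) (simp add: CAB mult_ac)
  also have "(\<Sum>a\<in>A. \<Sum>b\<in>B. w a * w b * C a b) = near_far_sum p l r k"
    unfolding near_far_sum_def AB by (intro sum.cong refl) (simp add: CAB w_def)
  also have "(\<Sum>a\<in>A. \<Sum>b\<in>A. w a * w b * C a b) = (\<Sum>i<k. near_sum p l r i * near_sum p l r (k - 1 - i))"
  proof -
    have "(\<Sum>a\<in>A. \<Sum>b\<in>A. w a * w b * C a b)
      = (\<Sum>a\<in>A. \<Sum>b\<in>A. \<Sum>i<k. (w a * (a - l) ^ i) * (w b * (b - l) ^ (k - 1 - i)))"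
      by (intro sum.cong refl) (simp add: C_def sum_distrib_left mult_ac)
    also have "\<dots> = (\<Sum>a\<in>A. \<Sum>i<k. \<Sum>b\<in>A. (w a * (a - l) ^ i) * (w b * (b - l) ^ (k - 1 - i)))"
      by (intro sum.cong refl sum.swap)
    also have "\<dots> = (\<Sum>i<k. \<Sum>a\<in>A. \<Sum>b\<in>A. (w a * (a - l) ^ i) * (w b * (b - l) ^ (k - 1 - i)))"
      by (rule sum.swap)
    also have "\<dots> = (\<Sum>i<k. near_sum p l r i * near_sum p l r (k - 1 - i))"
      by (simp only: ns sum_product)
    finally show ?thesis .
  qed
  also have "(\<Sum>a\<in>Z. w a * C a a) = of_nat k * near_sum p l r (k - 1)"
  proof -
    have "(a - l) ^ i * (a - l) ^ (k - 1 - i) = (a - l) ^ (k - 1)" if "i < k" for a i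
      unfolding power_add[symmetric] using that by simp
    then have "(\<Sum>i<k. (a - l) ^ i * (a - l) ^ (k - 1 - i)) = of_nat k * (a - l) ^ (k - 1)" for a
      by simp
    then have "(\<Sum>a\<in>A. w a * C a a) = of_nat k * near_sum p l r (k - 1)"
      by (simp add: C_def ns sum_distrib_left mult_ac)
    moreover have "(\<Sum>a\<in>B. w a * C a a) = 0" using Z(2) by (intro sum.neutral) (auto simp: C_def)
    ultimately show ?thesis unfolding Z(1) using Z(2) by (simp add: sum.union_disjoint)
  qed
  finally have "((\<lambda>z. (\<Sum>(a, b)\<in>Z \<times> Z. w a * w b * ((z - l) ^ k / ((z - a) * (z - b))))
        - (\<Sum>a\<in>Z. w a * ((z - l) ^ k / ((z - a) * (z - a))))) has_contour_integral
     2 * pi * \<i> * ((\<Sum>i<k. near_sum p l r i * near_sum p l r (k - 1 - i)) - of_nat k * near_sum p l r (k - 1)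
      + 2 * near_far_sum p l r k)) (circlepath l r)"
    by (simp only: alg)
  then show ?thesis
  proof (rule has_contour_integral_eq)
    fix z assume "z \<in> path_image (circlepath l r)"
    then have "poly p z \<noteq> 0" using nz r by simp
    then show "(\<Sum>(a, b)\<in>Z \<times> Z. w a * w b * ((z - l) ^ k / ((z - a) * (z - b))))
        - (\<Sum>a\<in>Z. w a * ((z - l) ^ k / ((z - a) * (z - a)))) = (z - l) ^ k * (poly (pderiv (pderiv p)) z / poly p z)"
    proof -
      have "poly (pderiv (pderiv p)) z / poly p z = (\<Sum>(a, b)\<in>Z \<times> Z. w a * w b / ((z - a) * (z - b)))
          - (\<Sum>a\<in>Z. w a / ((z - a) * (z - a)))"
        using \<open>poly p z \<noteq> 0\<close> poly_pderiv2_eq_sum_roots[of p z] by (simp add: Z_def w_def)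
      then show ?thesis
        by (simp add: sum_distrib_left right_diff_distrib case_prod_unfold mult_ac)
    qed
  qed
qed

section \<open>Differentiating contour integrals along the flow\<close>

lemma continuous_heat_flow:
  "continuous_on S (\<lambda>x. poly (heat_flow (f x) p) (g x))" if "continuous_on S f" "continuous_on S g"
proof -
  have "degree p < 2 * Suc (degree p)" by simp
  then have eq: "poly (heat_flow s p) z
      = (\<Sum>k<Suc (degree p). complex_of_real ((- s) ^ k / fact k) * poly ((pderiv ^^ (2 * k)) p) z)" for s z
    by (simp only: heat_flow_upto poly_sum poly_smult)
  show ?thesis unfolding eq by (intro continuous_intros that) auto
qed

lemma DERIV_heat_flow_square:
  "((\<lambda>\<tau>. poly (heat_flow (\<tau>\<^sup>2 / (2 * real N)) p) z) has_vector_derivative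
    - of_real (\<tau> / real N) * poly (heat_flow (\<tau>\<^sup>2 / (2 * real N)) (pderiv (pderiv p))) z) (at \<tau> within A)"
proof -
  have "((\<lambda>\<tau>. \<tau>\<^sup>2) has_real_derivative 2 * \<tau>) (at \<tau>)"
    by (auto intro!: derivative_eq_intros)
  from DERIV_cdivide[OF this, of "2 * real N"]
  have "((\<lambda>\<tau>. \<tau>\<^sup>2 / (2 * real N)) has_vector_derivative \<tau> / real N) (at \<tau>)"
    by (simp add: has_real_derivative_iff_has_vector_derivative)
  from vector_diff_chain_at[OF this DERIV_heat_flow[of p z]]
  have "((\<lambda>\<tau>. poly (heat_flow (\<tau>\<^sup>2 / (2 * real N)) p) z) has_vector_derivative
    - of_real (\<tau> / real N) * poly (heat_flow (\<tau>\<^sup>2 / (2 * real N)) (pderiv (pderiv p))) z) (at \<tau>)"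
    by (simp add: o_def scaleR_conv_of_real)
  then show ?thesis by (rule has_vector_derivative_at_within)
qed

lemma has_vector_derivative_divide_complex:
  fixes f g :: "real \<Rightarrow> complex"
  assumes f: "(f has_vector_derivative f') (at x within S)"
    and g: "(g has_vector_derivative g') (at x within S)" and nz: "g x \<noteq> 0"
  shows "((\<lambda>x. f x / g x) has_vector_derivative (f' * g x - f x * g') / (g x)\<^sup>2) (at x within S)"
proof -
  have "((\<lambda>x. inverse (g x)) has_vector_derivative g' * - (inverse (g x) ^ Suc (Suc 0))) (at x within S)"
    using field_vector_diff_chain_within[OF g has_field_derivative_at_within[OF DERIV_inverse[OF nz]]]
    by (simp add: o_def)
  then have "((\<lambda>x. f x * inverse (g x)) has_vector_derivative
      f x * (g' * - (inverse (g x) ^ Suc (Suc 0))) + f' * inverse (g x)) (at x within S)"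
    by (rule has_vector_derivative_mult[OF f])
  then show ?thesis using nz by (simp add: field_simps power2_eq_square)
qed

text \<open>Integration by parts on a closed curve. For p2 = p'' the quotient is minus the
  s-derivative of p' / p under the heat flow, so this evaluates the time derivative of a power
  sum.\<close>

lemma contour_log_deriv:
  assumes r: "0 < r" and nz: "\<And>z. z \<in> sphere l r \<Longrightarrow> poly p z \<noteq> 0"
    and I: "((\<lambda>z. (z - l) ^ (k - 1) * (poly p2 z / poly p z)) has_contour_integral 2 * pi * \<i> * V) (circlepath l r)"
  shows "((\<lambda>z. (z - l) ^ k * ((poly (pderiv p2) z * poly p z - poly (pderiv p) z * poly p2 z) / (poly p z)\<^sup>2))
    has_contour_integral - (of_nat k * (2 * pi * \<i> * V))) (circlepath l r)"
proof -
  define U where "U = {z. poly p z \<noteq> 0}"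
  define G where "G = (\<lambda>z. of_nat k * ((z - l) ^ (k - 1) * (poly p2 z / poly p z)))"
  define H where "H = (\<lambda>z. (z - l) ^ k * ((poly (pderiv p2) z * poly p z - poly (pderiv p) z * poly p2 z) / (poly p z)\<^sup>2))"
  have "((\<lambda>z. G z + H z) has_contour_integral 0) (circlepath l r)"
  proof (rule Cauchy_theorem_primitive[where f = "\<lambda>z. (z - l) ^ k * (poly p2 z / poly p z)" and S = U])
    fix x assume "x \<in> U"
    then have x: "poly p x \<noteq> 0" by (simp add: U_def)
    have "((\<lambda>z. (z - l) ^ k) has_field_derivative of_nat k * (x - l) ^ (k - 1)) (at x within U)"
      by (auto intro!: derivative_eq_intros)
    moreover have "((\<lambda>z. poly p2 z / poly p z) has_field_derivative
        (poly (pderiv p2) x * poly p x - poly p2 x * poly (pderiv p) x) / (poly p x * poly p x)) (at x within U)"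
      by (intro DERIV_divide has_field_derivative_at_within[OF poly_DERIV] x)
    ultimately show "((\<lambda>z. (z - l) ^ k * (poly p2 z / poly p z)) has_field_derivative G x + H x) (at x within U)"
      by (rule DERIV_mult[THEN DERIV_cong])
         (simp add: G_def H_def power2_eq_square mult_ac)
  qed (use nz r in \<open>auto simp: U_def\<close>)
  moreover have "(G has_contour_integral of_nat k * (2 * pi * \<i> * V)) (circlepath l r)"
    unfolding G_def by (intro has_contour_integral_lmul I)
  ultimately have "((\<lambda>z. (G z + H z) - G z) has_contour_integral 0 - of_nat k * (2 * pi * \<i> * V)) (circlepath l r)"
    by (rule has_contour_integral_diff)
  then show ?thesis by (simp add: H_def)
qed

text \<open>Differentiation under the integral sign, legitimate because the circle stays free of
  zeros for all times in the interval. The residue V is left abstract;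
  \<open>contour_near_sum2\<close> supplies it.\<close>

lemma near_sum_has_vector_derivative:
  fixes q :: "complex poly" and l :: complex and N :: nat
  defines "P \<equiv> \<lambda>\<tau>. heat_flow (\<tau>\<^sup>2 / (2 * real N)) q"
  assumes r: "0 < r" and nz: "\<And>\<tau> z. \<tau> \<in> {0..T} \<Longrightarrow> z \<in> sphere l r \<Longrightarrow> poly (P \<tau>) z \<noteq> 0"
    and \<tau>: "\<tau> \<in> {0..T}"
    and I: "((\<lambda>z. (z - l) ^ (k - 1) * (poly (pderiv (pderiv (P \<tau>))) z / poly (P \<tau>) z))
      has_contour_integral 2 * pi * \<i> * V) (circlepath l r)"
  shows "((\<lambda>\<tau>. near_sum (P \<tau>) l r k) has_vector_derivative of_real (\<tau> / real N) * of_nat k * V)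
    (at \<tau> within {0..T})"
proof -
  define c where "c = circlepath l r"
  define c' where "c' = (\<lambda>x. vector_derivative c (at x))"
  define h where "h = (\<lambda>p \<tau>. poly (heat_flow (\<tau>\<^sup>2 / (2 * real N)) p))"
  define q1 where "q1 = pderiv q"
  define q2 where "q2 = pderiv q1"
  define q3 where "q3 = pderiv q2"
  note qs = q1_def q2_def q3_def
  have c: "c x = l + of_real r * exp (2 * of_real pi * \<i> * of_real x)"
    "c' x = 2 * of_real pi * \<i> * of_real r * exp (2 * of_real pi * \<i> * of_real x)" for x
    by (simp add: c_def circlepath, simp add: c_def c'_def vector_derivative_circlepath)
  have nzc: "h q \<tau> (c x) \<noteq> 0" if "\<tau> \<in> {0..T}" for \<tau> x
    using nz[OF that, of "c x"] r by (simp add: c dist_norm norm_mult h_def P_def)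
  define f where "f = (\<lambda>\<tau> x. (c x - l) ^ k * (h q1 \<tau> (c x) / h q \<tau> (c x)) * c' x)"
  define fx where "fx = (\<lambda>\<tau> x. (c x - l) ^ k * (- of_real (\<tau> / real N) *
    ((h q3 \<tau> (c x) * h q \<tau> (c x) - h q1 \<tau> (c x) * h q2 \<tau> (c x)) / (h q \<tau> (c x))\<^sup>2)) * c' x)"
  have cont_c [continuous_intros]: "continuous_on S (\<lambda>x. c (u x))" "continuous_on S (\<lambda>x. c' (u x))"
    if "continuous_on S u" for u :: "'b::topological_space \<Rightarrow> real" and S
    unfolding c by (intro continuous_intros that)+
  have cont_h [continuous_intros]: "continuous_on S (\<lambda>x. h p (u x) (v x))"
    if "continuous_on S u" "continuous_on S v" for u v p and S :: "'b::topological_space set"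
    unfolding h_def divide_inverse by (intro continuous_heat_flow continuous_intros that)
  have "((\<lambda>\<tau>. integral (cbox 0 1) (f \<tau>)) has_vector_derivative integral (cbox 0 1) (fx \<tau>)) (at \<tau> within {0..T})"
  proof (rule leibniz_rule_vector_derivative)
    fix \<tau> :: real and x :: real assume \<tau>: "\<tau> \<in> {0..T}"
    have d1: "((\<lambda>\<tau>. h q1 \<tau> (c x)) has_vector_derivative - of_real (\<tau> / real N) * h q3 \<tau> (c x)) (at \<tau> within {0..T})"
      and d0: "((\<lambda>\<tau>. h q \<tau> (c x)) has_vector_derivative - of_real (\<tau> / real N) * h q2 \<tau> (c x)) (at \<tau> within {0..T})"
      unfolding h_def qs by (rule DERIV_heat_flow_square)+
    have "((\<lambda>\<tau>. h q1 \<tau> (c x) / h q \<tau> (c x)) has_vector_derivative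
        - of_real (\<tau> / real N) * ((h q3 \<tau> (c x) * h q \<tau> (c x) - h q1 \<tau> (c x) * h q2 \<tau> (c x)) / (h q \<tau> (c x))\<^sup>2))
        (at \<tau> within {0..T})"
      using has_vector_derivative_divide_complex[OF d1 d0 nzc[OF \<tau>]]
      by (rule has_vector_derivative_eq_rhs) (simp add: algebra_simps diff_divide_distrib)
    then show "((\<lambda>\<tau>. f \<tau> x) has_vector_derivative fx \<tau> x) (at \<tau> within {0..T})"
      unfolding f_def fx_def
      by (intro has_vector_derivative_mult_left has_vector_derivative_mult_right)
  next
    fix \<tau> assume "\<tau> \<in> {0..T}"
    then show "f \<tau> integrable_on cbox 0 1"
      unfolding f_def using nzc by (intro integrable_continuous continuous_intros) auto
  next
    show "continuous_on ({0..T} \<times> cbox 0 1) (\<lambda>(\<tau>, x). fx \<tau> x)"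
      unfolding fx_def case_prod_unfold divide_inverse[of _ "real N"] using nzc
      by (intro continuous_intros) auto
  qed (use \<tau> in auto)
  also have "integral (cbox 0 1) (fx \<tau>) = of_real (\<tau> / real N) * (of_nat k * (2 * pi * \<i> * V))"
  proof -
    have "((\<lambda>z. - of_real (\<tau> / real N) * ((z - l) ^ k * ((poly (pderiv (pderiv (pderiv (P \<tau>)))) z * poly (P \<tau>) z
         - poly (pderiv (P \<tau>)) z * poly (pderiv (pderiv (P \<tau>))) z) / (poly (P \<tau>) z)\<^sup>2)))
      has_contour_integral - of_real (\<tau> / real N) * - (of_nat k * (2 * pi * \<i> * V))) c"
      unfolding c_def using contour_log_deriv[OF r nz[OF \<tau>] I] by (intro has_contour_integral_lmul) auto
    then have "(fx \<tau> has_integral - of_real (\<tau> / real N) * - (of_nat k * (2 * pi * \<i> * V))) {0..1}"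
      unfolding has_contour_integral
      by (rule has_integral_eq[rotated])
        (simp add: fx_def h_def P_def qs c'_def pderiv_heat_flow mult_ac)
    then show ?thesis by (simp add: integral_unique)
  qed
  finally have main: "((\<lambda>\<tau>. integral (cbox 0 1) (f \<tau>) / (2 * pi * \<i>)) has_vector_derivative
      of_real (\<tau> / real N) * (of_nat k * (2 * pi * \<i> * V)) / (2 * pi * \<i>)) (at \<tau> within {0..T})"
    by (rule has_vector_derivative_divide)
  have eq: "integral (cbox 0 1) (f \<tau>) / (2 * pi * \<i>) = near_sum (P \<tau>) l r k" if "\<tau> \<in> {0..T}" for \<tau>
  proof -
    have "((\<lambda>z. (z - l) ^ k * (poly (pderiv (P \<tau>)) z / poly (P \<tau>) z)) has_contour_integral
      2 * pi * \<i> * near_sum (P \<tau>) l r k) c"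
      unfolding c_def by (rule contour_near_sum[OF r nz[OF that]])
    then have "(f \<tau> has_integral 2 * pi * \<i> * near_sum (P \<tau>) l r k) {0..1}"
      unfolding has_contour_integral
      by (rule has_integral_eq[rotated])
        (simp add: f_def h_def P_def qs c'_def pderiv_heat_flow mult_ac)
    then show ?thesis by (simp add: integral_unique)
  qed
  have "of_real (\<tau> / real N) * (of_nat k * (2 * pi * \<i> * V)) / (2 * pi * \<i>) = of_real (\<tau> / real N) * of_nat k * V"
    by simp
  with has_vector_derivative_transform[OF \<tau> eq[symmetric] main] show ?thesis by (simp add: mult.assoc)
qed

section \<open>Moment asymptotics of a cluster\<close>

text \<open>Odd entries vanish and entry 2 m is the m-th Catalan number. The recursion advances by
  one \<open>Suc\<close>, the empty sum giving entry 1 the value 0, to match the moment equation of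
  a cluster.\<close>

fun semicircle_moment :: "nat \<Rightarrow> real" where
  "semicircle_moment 0 = 1"
| "semicircle_moment (Suc k) = (\<Sum>i<k. semicircle_moment i * semicircle_moment (k - 1 - i))"

declare semicircle_moment.simps(2) [simp del]

text \<open>The powers of the base polynomial will be instances with one \<sigma> for all n, so
  bounds that depend on \<sigma> alone are uniform in n.\<close>

locale separated_root =
  fixes q :: "complex poly" and N :: nat and l :: complex and \<sigma> :: real
  assumes deg: "degree q = N" and N: "0 < N" and \<sigma>: "0 < \<sigma>"
    and sep: "\<And>y. poly q y = 0 \<Longrightarrow> y \<noteq> l \<Longrightarrow> \<sigma> \<le> cmod (y - l)"
begin

definition P :: "real \<Rightarrow> complex poly" where
  "P \<tau> = heat_flow (\<tau>\<^sup>2 / (2 * real N)) q"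

definition M :: "nat \<Rightarrow> real \<Rightarrow> complex" where
  "M k \<tau> = near_sum (P \<tau>) l (\<sigma> / 2) k / of_nat N"

lemma q_nz: "q \<noteq> 0" using deg N by auto

lemma degree_P: "degree (P \<tau>) = N" by (simp add: P_def deg)

lemma P_nz: "P \<tau> \<noteq> 0"
  using degree_P[of \<tau>] N by (metis degree_0 less_irrefl)

context
  fixes \<tau> assumes \<tau>: "0 \<le> \<tau>" "\<tau> \<le> \<sigma> / 8"
begin

text \<open>The root y of q near z is closer to l than 3 \<sigma> / 4 + 2 \<tau> <= \<sigma>, hence
  y = l. So zeros avoid the distances from l between 2 \<tau> <= \<sigma> / 4 and 3 \<sigma> / 4,
  and the circle of radius \<sigma> / 2 runs inside this gap.\<close>

lemma root_near:
  assumes "poly (P \<tau>) z = 0" "cmod (z - l) < 3 * \<sigma> / 4"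
  shows "cmod (z - l) \<le> 2 * \<tau>"
proof -
  obtain y where y: "poly q y = 0" "cmod (z - y) \<le> 2 * \<tau>"
    using heat_flow_zero_near[of q N \<tau> z] assms deg N \<tau> q_nz by (auto simp: P_def)
  have "cmod (y - l) \<le> cmod (z - l) + cmod (z - y)"
    using norm_triangle_ineq4[of "z - l" "z - y"] by simp
  also have "\<dots> < \<sigma>" using assms y \<tau> by simp
  finally show ?thesis using sep y by fastforce
qed

lemma root_Im:
  assumes "poly (P \<tau>) z = 0" "cmod (z - l) < 3 * \<sigma> / 4"
  shows "\<bar>Im (z - l)\<bar> \<le> 8 * \<tau>\<^sup>2 / \<sigma>"
  using heat_flow_zero_Im[of q N \<tau> \<sigma> l z] assms root_near[OF assms] deg N \<tau> q_nz \<sigma> sep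
  by (simp add: P_def)

lemma sphere_nz:
  assumes "z \<in> sphere l (\<sigma> / 2)"
  shows "poly (P \<tau>) z \<noteq> 0"
proof
  have z: "cmod (z - l) = \<sigma> / 2" using assms by (metis dist_commute dist_norm mem_sphere)
  assume "poly (P \<tau>) z = 0"
  then have "cmod (z - l) \<le> 2 * \<tau>" using root_near z \<sigma> by simp
  then show False using z \<tau> \<sigma> by simp
qed

lemma sum_order_le:
  assumes "\<And>z. Q z \<Longrightarrow> poly (P \<tau>) z = 0"
  shows "(\<Sum>z | Q z. real (order z (P \<tau>))) \<le> real N"
proof -
  have "(\<Sum>z | Q z. order z (P \<tau>)) \<le> (\<Sum>z | poly (P \<tau>) z = 0. order z (P \<tau>))"
    using assms poly_roots_finite[OF P_nz[of \<tau>]] by (intro sum_mono2) auto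
  also have "\<dots> = N" by (simp add: sum_order_complex P_nz degree_P)
  finally show ?thesis by (simp flip: of_nat_sum)
qed

lemma norm_M_le: "cmod (M k \<tau>) \<le> (2 * \<tau>) ^ k"
proof -
  have "cmod (near_sum (P \<tau>) l (\<sigma> / 2) k)
      \<le> (\<Sum>z | poly (P \<tau>) z = 0 \<and> cmod (z - l) < \<sigma> / 2. real (order z (P \<tau>)) * (2 * \<tau>) ^ k)"
    unfolding near_sum_def
  proof (rule sum_norm_le)
    fix z assume "z \<in> {z. poly (P \<tau>) z = 0 \<and> cmod (z - l) < \<sigma> / 2}"
    then have "cmod (z - l) ^ k \<le> (2 * \<tau>) ^ k" using root_near[of z] \<sigma> by (intro power_mono) auto
    then show "cmod (of_nat (order z (P \<tau>)) * (z - l) ^ k) \<le> real (order z (P \<tau>)) * (2 * \<tau>) ^ k"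
      unfolding norm_mult norm_power norm_of_nat by (rule mult_left_mono) simp
  qed
  also have "\<dots> \<le> real N * (2 * \<tau>) ^ k"
    unfolding sum_distrib_right[symmetric] using \<tau> by (intro mult_right_mono sum_order_le) auto
  finally show ?thesis using N by (simp add: M_def norm_divide field_simps)
qed

text \<open>Far zeros are at least 3 \<sigma> / 4 and cluster zeros at most \<sigma> / 4 away from
  l, so each force is at most 2 / \<sigma>; there are at most N^2 pairs.\<close>

lemma norm_near_far_le: "cmod (near_far_sum (P \<tau>) l (\<sigma> / 2) k) \<le> (real N)\<^sup>2 * ((2 * \<tau>) ^ k * (2 / \<sigma>))"
proof -
  define A where "A = {z. poly (P \<tau>) z = 0 \<and> cmod (z - l) < \<sigma> / 2}"
  define B where "B = {z. poly (P \<tau>) z = 0 \<and> \<not> cmod (z - l) < \<sigma> / 2}"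
  define w where "w = (\<lambda>z. real (order z (P \<tau>)))"
  have "cmod (of_nat (order a (P \<tau>)) * of_nat (order b (P \<tau>)) * ((a - l) ^ k / (a - b)))
      \<le> w a * (w b * ((2 * \<tau>) ^ k * (2 / \<sigma>)))" if "a \<in> A" "b \<in> B" for a b
  proof -
    have a: "cmod (a - l) \<le> 2 * \<tau>" using root_near[of a] that \<sigma> by (simp add: A_def)
    have b: "3 * \<sigma> / 4 \<le> cmod (b - l)" using root_near[of b] that \<sigma> \<tau> by (force simp: B_def not_less)
    have "cmod (b - l) \<le> cmod (a - b) + cmod (a - l)"
      using norm_triangle_ineq4[of "a - l" "a - b"] by simp
    then have "\<sigma> / 2 \<le> cmod (a - b)" using a b \<tau> by simp
    moreover have "cmod (a - l) ^ k \<le> (2 * \<tau>) ^ k" using a by (intro power_mono) auto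
    ultimately have "cmod ((a - l) ^ k) / cmod (a - b) \<le> (2 * \<tau>) ^ k / (\<sigma> / 2)"
      unfolding norm_power using \<sigma> \<tau> by (intro frac_le zero_le_power) auto
    then have "w a * (w b * (cmod ((a - l) ^ k) / cmod (a - b))) \<le> w a * (w b * ((2 * \<tau>) ^ k / (\<sigma> / 2)))"
      by (intro mult_left_mono) (auto simp: w_def)
    then show ?thesis by (simp add: norm_mult norm_divide w_def mult_ac)
  qed
  then have "cmod (near_far_sum (P \<tau>) l (\<sigma> / 2) k) \<le> (\<Sum>a\<in>A. \<Sum>b\<in>B. w a * (w b * ((2 * \<tau>) ^ k * (2 / \<sigma>))))"
    unfolding near_far_sum_def A_def[symmetric] B_def[symmetric] by (intro sum_norm_le) auto
  also have "\<dots> = sum w A * (sum w B * ((2 * \<tau>) ^ k * (2 / \<sigma>)))"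
    by (simp only: sum_distrib_left[symmetric] sum_distrib_right[symmetric])
  also have "\<dots> \<le> real N * (real N * ((2 * \<tau>) ^ k * (2 / \<sigma>)))"
    using \<sigma> \<tau> unfolding w_def A_def B_def
    by (intro mult_mono sum_order_le mult_right_mono sum_nonneg mult_nonneg_nonneg) auto
  finally show ?thesis by (simp add: power2_eq_square mult_ac)
qed

end

text \<open>The prefactor 1 / N and the normalisation of \<open>M\<close> together absorb the N^2
  pairs, whereas the diagonal is smaller by 1 / N. Apart from the far term only moments of order
  below k enter, so the system can be integrated recursively.\<close>

lemma M_has_vector_derivative:
  assumes \<tau>: "\<tau> \<in> {0..\<sigma> / 8}"
  shows "(M (Suc k) has_vector_derivative of_real (\<tau> * real (Suc k)) *
      ((\<Sum>i<k. M i \<tau> * M (k - 1 - i) \<tau>) - of_nat k * M (k - 1) \<tau> / of_nat N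
       + 2 * near_far_sum (P \<tau>) l (\<sigma> / 2) k / (of_nat N)\<^sup>2)) (at \<tau> within {0..\<sigma> / 8})"
    and "(M 0 has_vector_derivative 0) (at \<tau> within {0..\<sigma> / 8})"
proof -
  have nz: "poly (heat_flow (\<tau>\<^sup>2 / (2 * real N)) q) z \<noteq> 0"
    if "\<tau> \<in> {0..\<sigma> / 8}" "z \<in> sphere l (\<sigma> / 2)" for \<tau> z
    using sphere_nz[of \<tau> z] that by (simp add: P_def)
  have r: "0 < \<sigma> / 2" using \<sigma> by simp
  have d: "((\<lambda>\<tau>. near_sum (P \<tau>) l (\<sigma> / 2) k) has_vector_derivative of_real (\<tau> / real N) * of_nat k *
      ((\<Sum>i<k - 1. near_sum (P \<tau>) l (\<sigma> / 2) i * near_sum (P \<tau>) l (\<sigma> / 2) (k - 1 - 1 - i))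
      - of_nat (k - 1) * near_sum (P \<tau>) l (\<sigma> / 2) (k - 1 - 1) + 2 * near_far_sum (P \<tau>) l (\<sigma> / 2) (k - 1)))
      (at \<tau> within {0..\<sigma> / 8})" for k
    using near_sum_has_vector_derivative[OF r nz \<tau> contour_near_sum2[OF r nz[OF \<tau>]]]
    unfolding P_def .
  have "((\<lambda>\<tau>. near_sum (P \<tau>) l (\<sigma> / 2) (Suc k) / of_nat N) has_vector_derivative of_real (\<tau> * real (Suc k)) *
      ((\<Sum>i<k. M i \<tau> * M (k - 1 - i) \<tau>) - of_nat k * M (k - 1) \<tau> / of_nat N
       + 2 * near_far_sum (P \<tau>) l (\<sigma> / 2) k / (of_nat N)\<^sup>2)) (at \<tau> within {0..\<sigma> / 8})"
    using has_vector_derivative_divide[OF d[of "Suc k"], of "of_nat N"]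
    by (rule has_vector_derivative_eq_rhs) (use N in \<open>simp add: M_def field_simps power2_eq_square sum_divide_distrib sum_distrib_left\<close>)
  then show "(M (Suc k) has_vector_derivative of_real (\<tau> * real (Suc k)) *
      ((\<Sum>i<k. M i \<tau> * M (k - 1 - i) \<tau>) - of_nat k * M (k - 1) \<tau> / of_nat N
       + 2 * near_far_sum (P \<tau>) l (\<sigma> / 2) k / (of_nat N)\<^sup>2)) (at \<tau> within {0..\<sigma> / 8})"
    by (simp add: M_def[abs_def])
  show "(M 0 has_vector_derivative 0) (at \<tau> within {0..\<sigma> / 8})"
    using has_vector_derivative_divide[OF d[of 0], of "of_nat N"] by (simp add: M_def[abs_def])
qed

end

section \<open>Comparison with the semicircle moments\<close>

lemma heat_flow_at_0: "heat_flow 0 p = p"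
proof -
  have "degree p < 2 * Suc (degree p)" by simp
  then show ?thesis
    by (subst heat_flow_upto[where K="Suc (degree p)"], simp, subst sum.lessThan_Suc_shift) simp
qed

context separated_root
begin

definition \<beta> :: real where "\<beta> = real (order l q) / real N"

text \<open>The k-th moment of the semicircular measure of mass \<beta> and standard deviation
  sqrt(\<beta>) \<tau>.\<close>

definition C :: "nat \<Rightarrow> real \<Rightarrow> real" where
  "C k \<tau> = \<beta> * (sqrt \<beta> * \<tau>) ^ k * semicircle_moment k"

lemma \<beta>: "0 \<le> \<beta>" "\<beta> \<le> 1"
  using order_degree[OF q_nz, of l] N by (auto simp: \<beta>_def deg)

text \<open>The number of zeros in the disc is conserved, and at \<tau> = 0 it is the order of
  l.\<close>

lemma M_0: assumes "0 \<le> \<tau>" "\<tau> \<le> \<sigma> / 8" shows "M 0 \<tau> = of_real (C 0 \<tau>)"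
proof -
  obtain v where v: "\<And>\<tau>. \<tau> \<in> {0..\<sigma> / 8} \<Longrightarrow> M 0 \<tau> = v"
    using has_vector_derivative_zero_constant[of "{0..\<sigma> / 8}" "M 0"] M_has_vector_derivative(2) by auto
  have "{z. poly q z = 0 \<and> cmod (z - l) < \<sigma> / 2} = (if poly q l = 0 then {l} else {})"
    using sep \<sigma> by force
  then have "near_sum q l (\<sigma> / 2) 0 = of_nat (order l q)"
    by (simp add: near_sum_def order_0I)
  then have "M 0 0 = of_real (C 0 \<tau>)" by (simp add: M_def P_def heat_flow_at_0 C_def \<beta>_def)
  then show ?thesis using v[of 0] v[of \<tau>] assms \<sigma> by simp
qed

text \<open>Up to the factor k + 1 the right side is the derivative of \<open>C (Suc k)\<close>:
  \<open>C\<close> solves the moment equation without its error terms. The left side has one more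
  factor \<beta> of mass, which is absorbed as the square of sqrt(\<beta>).\<close>

lemma C_convolution:
  "\<tau> * (\<Sum>i<k. C i \<tau> * C (k - 1 - i) \<tau>) = \<beta> * sqrt \<beta> ^ Suc k * \<tau> ^ k * semicircle_moment (Suc k)"
proof (cases k)
  case 0
  then show ?thesis by (simp add: semicircle_moment.simps(2))
next
  case (Suc j)
  have "C i \<tau> * C (k - 1 - i) \<tau> = \<beta> * \<beta> * (sqrt \<beta> * \<tau>) ^ j * (semicircle_moment i * semicircle_moment (k - 1 - i))"
    if "i < k" for i
  proof -
    have "(sqrt \<beta> * \<tau>) ^ i * (sqrt \<beta> * \<tau>) ^ (k - 1 - i) = (sqrt \<beta> * \<tau>) ^ j"
      unfolding power_add[symmetric] using that Suc by simp
    moreover have "C i \<tau> * C j' \<tau> = \<beta> * \<beta> * ((sqrt \<beta> * \<tau>) ^ i * (sqrt \<beta> * \<tau>) ^ j')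
        * (semicircle_moment i * semicircle_moment j')" for j'
      by (simp only: C_def mult_ac)
    ultimately show ?thesis by simp
  qed
  then have S: "(\<Sum>i<k. C i \<tau> * C (k - 1 - i) \<tau>) = \<beta> * \<beta> * (sqrt \<beta> * \<tau>) ^ j * semicircle_moment (Suc k)"
    unfolding semicircle_moment.simps(2) by (simp add: sum_distrib_left)
  have "\<beta> * sqrt \<beta> ^ Suc k * \<tau> ^ k = \<tau> * (\<beta> * (sqrt \<beta> * sqrt \<beta>) * (sqrt \<beta> * \<tau>) ^ j)"
    by (simp only: Suc power_Suc power_mult_distrib mult_ac)
  moreover have "sqrt \<beta> * sqrt \<beta> = \<beta>" using \<beta> by simp
  ultimately have "\<tau> * (\<beta> * \<beta> * (sqrt \<beta> * \<tau>) ^ j) = \<beta> * sqrt \<beta> ^ Suc k * \<tau> ^ k"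
    by (simp only:)
  then show ?thesis unfolding S by (simp only: mult.assoc[symmetric])
qed

text \<open>Both functions vanish at 0 and have nearly the same derivative. \<open>B\<close>
  collects three errors: the convolution, split as M_i M_j - C_i C_j = (M_i - C_i) M_j + C_i (M_j -
  C_j); the diagonal, of relative size 1 / N; and the far force, which carries one more power of
  \<tau> than the convolution.\<close>

lemma norm_M_minus_C_step:
  assumes IH: "\<And>i \<tau>. i \<le> k \<Longrightarrow> 0 \<le> \<tau> \<Longrightarrow> \<tau> \<le> \<sigma> / 8 \<Longrightarrow>
      cmod (M i \<tau> - of_real (C i \<tau>)) \<le> A i * (\<tau> + 1 / real N) * \<tau> ^ i"
    and A: "\<And>i. i \<le> k \<Longrightarrow> 0 \<le> A i"
    and \<tau>: "0 \<le> \<tau>" "\<tau> \<le> \<sigma> / 8"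
  defines "B \<equiv> real (Suc k) * ((\<Sum>i<k. A i * 2 ^ (k - 1 - i) + \<bar>semicircle_moment i\<bar> * A (k - 1 - i))
    + real k * 2 ^ (k - 1) + 4 * 2 ^ k / \<sigma>)"
  shows "cmod (M (Suc k) \<tau> - of_real (C (Suc k) \<tau>)) \<le> B * (\<tau> + 1 / real N) * \<tau> ^ Suc k"
proof (cases "\<tau> = 0")
  case True
  have "M (Suc k) 0 = 0" using norm_M_le[of 0 "Suc k"] \<sigma> by simp
  then show ?thesis using True by (simp add: C_def)
next
  case False
  define e where "e = (\<lambda>\<tau>. M (Suc k) \<tau> - of_real (C (Suc k) \<tau>))"
  define D where "D = (\<lambda>\<tau>. of_real (\<tau> * real (Suc k)) *
    (((\<Sum>i<k. M i \<tau> * M (k - 1 - i) \<tau>) - of_nat k * M (k - 1) \<tau> / of_nat N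
       + 2 * near_far_sum (P \<tau>) l (\<sigma> / 2) k / (of_nat N)\<^sup>2)
      - of_real (\<Sum>i<k. C i \<tau> * C (k - 1 - i) \<tau>)))"
  have e: "(e has_vector_derivative D x) (at x within {0..\<sigma> / 8})" if "x \<in> {0..\<sigma> / 8}" for x
  proof -
    have "(C (Suc k) has_real_derivative \<beta> * (sqrt \<beta> ^ Suc k * (real (Suc k) * x ^ k)) * semicircle_moment (Suc k)) (at x within {0..\<sigma> / 8})"
    proof -
      have "((\<lambda>x. x ^ Suc k) has_real_derivative real (Suc k) * x ^ k) (at x within {0..\<sigma> / 8})"
        using DERIV_pow[of "Suc k" x] by simp
      then show ?thesis
        unfolding C_def[abs_def] power_mult_distrib by (intro DERIV_cmult_right DERIV_cmult)
    qed
    also have "\<beta> * (sqrt \<beta> ^ Suc k * (real (Suc k) * x ^ k)) * semicircle_moment (Suc k)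
        = real (Suc k) * (\<beta> * sqrt \<beta> ^ Suc k * x ^ k * semicircle_moment (Suc k))"
      by (simp only: mult_ac)
    also have "\<dots> = x * real (Suc k) * (\<Sum>i<k. C i x * C (k - 1 - i) x)"
      unfolding C_convolution[symmetric] by (simp only: mult_ac)
    finally have "((\<lambda>x. complex_of_real (C (Suc k) x)) has_vector_derivative
        of_real (x * real (Suc k) * (\<Sum>i<k. C i x * C (k - 1 - i) x))) (at x within {0..\<sigma> / 8})"
      by (intro has_vector_derivative_of_real) (simp add: has_real_derivative_iff_has_vector_derivative)
    from has_vector_derivative_diff[OF M_has_vector_derivative(1)[OF that, of k] this]
    show ?thesis unfolding e_def D_def right_diff_distrib of_real_mult by simp
  qed
  have D: "cmod (D x) \<le> B * (x + 1 / real N) * x ^ k" if x: "0 \<le> x" "x \<le> \<sigma> / 8" for x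
  proof -
    define E where "E = x + 1 / real N"
    have E: "0 \<le> E" "x \<le> E" "1 / real N \<le> E" using x by (auto simp: E_def)
    have 1: "x * cmod ((\<Sum>i<k. M i x * M (k - 1 - i) x) - of_real (\<Sum>i<k. C i x * C (k - 1 - i) x))
        \<le> (\<Sum>i<k. A i * 2 ^ (k - 1 - i) + \<bar>semicircle_moment i\<bar> * A (k - 1 - i)) * E * x ^ k"
    proof -
      have "cmod (M i x * M (k - 1 - i) x - of_real (C i x * C (k - 1 - i) x))
          \<le> (A i * 2 ^ (k - 1 - i) + \<bar>semicircle_moment i\<bar> * A (k - 1 - i)) * E * x ^ (k - 1)" if "i < k" for i
      proof -
        define j where "j = k - 1 - i"
        have x': "x ^ (k - 1) = x ^ i * x ^ j" using that by (simp add: j_def flip: power_add)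
        have "M i x * M j x - of_real (C i x * C j x)
          = (M i x - of_real (C i x)) * M j x + of_real (C i x) * (M j x - of_real (C j x))"
          by (simp add: algebra_simps)
        also have "cmod \<dots> \<le> (A i * E * x ^ i) * (2 * x) ^ j + (\<bar>semicircle_moment i\<bar> * x ^ i) * (A j * E * x ^ j)"
        proof (intro order_trans[OF norm_triangle_ineq] add_mono)
          show "cmod ((M i x - of_real (C i x)) * M j x) \<le> (A i * E * x ^ i) * (2 * x) ^ j"
            unfolding norm_mult using IH[of i x] norm_M_le[OF x, of j] that A[of i] E x
            by (intro mult_mono) (auto simp: E_def)
          have "\<bar>C i x\<bar> \<le> 1 * (1 * x) ^ i * \<bar>semicircle_moment i\<bar>"
            unfolding C_def abs_mult power_abs using \<beta> x
            by (intro mult_mono power_mono) (auto simp: abs_mult)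
          then have "\<bar>C i x\<bar> \<le> \<bar>semicircle_moment i\<bar> * x ^ i" by (simp add: mult.commute)
          moreover have "cmod (M j x - of_real (C j x)) \<le> A j * E * x ^ j"
            using IH[of j x] x that by (simp add: E_def j_def)
          ultimately show "cmod (of_real (C i x) * (M j x - of_real (C j x)))
            \<le> (\<bar>semicircle_moment i\<bar> * x ^ i) * (A j * E * x ^ j)"
            unfolding norm_mult norm_of_real using x by (intro mult_mono) auto
        qed
        also have "\<dots> = (A i * 2 ^ j + \<bar>semicircle_moment i\<bar> * A j) * E * x ^ (k - 1)"
          by (simp only: x' power_mult_distrib) (simp add: algebra_simps)
        finally show ?thesis by (simp add: j_def)
      qed
      then have "cmod (\<Sum>i<k. M i x * M (k - 1 - i) x - of_real (C i x * C (k - 1 - i) x))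
        \<le> (\<Sum>i<k. (A i * 2 ^ (k - 1 - i) + \<bar>semicircle_moment i\<bar> * A (k - 1 - i)) * E * x ^ (k - 1))"
        by (intro sum_norm_le) auto
      then have "x * cmod ((\<Sum>i<k. M i x * M (k - 1 - i) x) - of_real (\<Sum>i<k. C i x * C (k - 1 - i) x))
        \<le> x * ((\<Sum>i<k. A i * 2 ^ (k - 1 - i) + \<bar>semicircle_moment i\<bar> * A (k - 1 - i)) * E * x ^ (k - 1))"
        using x unfolding of_real_sum sum_subtractf[symmetric] sum_distrib_right[symmetric]
        by (intro mult_left_mono) auto
      \<comment> \<open>For k = 0 the product of x and x^(k - 1) is not x^k, but then the sum is
        empty.\<close>
      also have "\<dots> = (\<Sum>i<k. A i * 2 ^ (k - 1 - i) + \<bar>semicircle_moment i\<bar> * A (k - 1 - i)) * E * x ^ k"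
        by (cases k) auto
      finally show ?thesis .
    qed
    have 2: "x * cmod (of_nat k * M (k - 1) x / of_nat N) \<le> (real k * 2 ^ (k - 1)) * E * x ^ k"
    proof -
      have "x * cmod (of_nat k * M (k - 1) x / of_nat N) = x * (real k * cmod (M (k - 1) x) * (1 / real N))"
        by (simp add: norm_mult norm_divide)
      also have "\<dots> \<le> x * (real k * (2 * x) ^ (k - 1) * E)"
        using x E norm_M_le[OF x, of "k - 1"] by (intro mult_left_mono mult_mono) auto
      also have "\<dots> = (real k * 2 ^ (k - 1)) * E * x ^ k"
        by (cases k) (auto simp: power_mult_distrib)
      finally show ?thesis .
    qed
    have 3: "x * cmod (2 * near_far_sum (P x) l (\<sigma> / 2) k / (of_nat N)\<^sup>2) \<le> (4 * 2 ^ k / \<sigma>) * E * x ^ k"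
    proof -
      have "cmod (near_far_sum (P x) l (\<sigma> / 2) k) / (real N)\<^sup>2 \<le> (2 * x) ^ k * (2 / \<sigma>)"
        using norm_near_far_le[OF x, of k] N by (simp add: field_simps)
      then have "x * (2 * (cmod (near_far_sum (P x) l (\<sigma> / 2) k) / (real N)\<^sup>2)) \<le> E * (2 * ((2 * x) ^ k * (2 / \<sigma>)))"
        using E x by (intro mult_mono) auto
      then show ?thesis by (simp add: norm_mult norm_divide norm_power power_mult_distrib mult_ac)
    qed
    define S1 where "S1 = (\<Sum>i<k. M i x * M (k - 1 - i) x)"
    define S2 where "S2 = complex_of_real (\<Sum>i<k. C i x * C (k - 1 - i) x)"
    define a where "a = of_nat k * M (k - 1) x / of_nat N"
    define b where "b = 2 * near_far_sum (P x) l (\<sigma> / 2) k / (of_nat N)\<^sup>2"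
    have "S1 - a + b - S2 = (S1 - S2) - a + b" by simp
    also have "cmod \<dots> \<le> cmod (S1 - S2) + cmod a + cmod b"
      by (meson add_mono norm_triangle_ineq norm_triangle_ineq4 order_refl order_trans)
    finally have "x * cmod (S1 - a + b - S2) \<le> x * cmod (S1 - S2) + x * cmod a + x * cmod b"
      using x by (metis distrib_left mult_left_mono)
    also have "\<dots> \<le> ((\<Sum>i<k. A i * 2 ^ (k - 1 - i) + \<bar>semicircle_moment i\<bar> * A (k - 1 - i))
        + real k * 2 ^ (k - 1) + 4 * 2 ^ k / \<sigma>) * E * x ^ k"
      using 1 2 3 unfolding S1_def S2_def a_def b_def distrib_right by linarith
    finally have "real (Suc k) * (x * cmod (S1 - a + b - S2)) \<le> real (Suc k) * (((\<Sum>i<k. A i * 2 ^ (k - 1 - i) + \<bar>semicircle_moment i\<bar> * A (k - 1 - i))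
        + real k * 2 ^ (k - 1) + 4 * 2 ^ k / \<sigma>) * E * x ^ k)"
      by (rule mult_left_mono) simp
    moreover have "D x = of_real (x * real (Suc k)) * (S1 - a + b - S2)"
      by (simp only: D_def S1_def S2_def a_def b_def)
    then have "cmod (D x) = \<bar>x * real (Suc k)\<bar> * cmod (S1 - a + b - S2)"
      by (simp only: norm_mult norm_of_real)
    then have "cmod (D x) = real (Suc k) * (x * cmod (S1 - a + b - S2))"
      using x by (simp add: abs_mult)
    ultimately show ?thesis unfolding B_def E_def by (simp only: mult.assoc)
  qed
  have B: "0 \<le> B"
    unfolding B_def using A \<sigma> by (intro mult_nonneg_nonneg add_nonneg_nonneg sum_nonneg divide_nonneg_nonneg) auto
  have "0 < \<tau>" using False \<tau> by simp
  have "continuous_on {0..\<tau>} e"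
    using \<tau> by (intro continuous_on_subset[OF continuous_on_vector_derivative[of "{0..\<sigma> / 8}" e D]] e) auto
  moreover have "(e has_derivative (\<lambda>h. h *\<^sub>R D x)) (at x)" if "0 < x" "x < \<tau>" for x
  proof -
    have x: "x \<in> {0..\<sigma> / 8}" using that \<tau> by simp
    have "at x within {0..\<sigma> / 8} = at x"
      using that \<tau> by (intro at_within_Icc_at) auto
    then show ?thesis using e[OF x] unfolding has_vector_derivative_def by (simp only:)
  qed
  ultimately have "\<exists>x\<in>{0<..<\<tau>}. norm (e \<tau> - e 0) \<le> norm ((\<tau> - 0) *\<^sub>R D x)"
    by (rule mvt_general[OF \<open>0 < \<tau>\<close>])
  then obtain x where x: "x \<in> {0<..<\<tau>}" "norm (e \<tau> - e 0) \<le> norm ((\<tau> - 0) *\<^sub>R D x)"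
    by blast
  have e0: "e 0 = 0" using norm_M_le[of 0 "Suc k"] \<sigma> by (simp add: e_def C_def)
  have "cmod (e \<tau>) \<le> \<tau> * cmod (D x)" using x(2) \<tau> by (simp add: e0)
  also have "\<dots> \<le> \<tau> * (B * (x + 1 / real N) * x ^ k)"
    using x(1) \<tau> by (intro mult_left_mono D) auto
  also have "\<dots> \<le> \<tau> * (B * (\<tau> + 1 / real N) * \<tau> ^ k)"
  proof (rule mult_left_mono[OF mult_mono])
    show "B * (x + 1 / real N) \<le> B * (\<tau> + 1 / real N)"
      using x(1) B by (intro mult_left_mono) auto
    show "x ^ k \<le> \<tau> ^ k" using x(1) by (intro power_mono) auto
  qed (use x(1) \<tau> B in auto)
  finally show ?thesis by (simp only: e_def power_Suc mult_ac)
qed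

end

text \<open>The order of quantifiers is the point: A depends on k and \<sigma> only, so the bound is
  uniform over all polynomials with that gap. Quantifying over the instances requires a statement
  outside the locale.\<close>

lemma moment_estimate:
  assumes \<sigma>: "0 < \<sigma>"
  shows "\<exists>A\<ge>0. \<forall>q N l \<tau>. separated_root q N l \<sigma> \<longrightarrow> 0 \<le> \<tau> \<longrightarrow> \<tau> \<le> \<sigma> / 8 \<longrightarrow>
    cmod (separated_root.M q N l \<sigma> k \<tau> - of_real (separated_root.C q N l k \<tau>)) \<le> A * (\<tau> + 1 / real N) * \<tau> ^ k"
proof (induction k rule: less_induct)
  case (less k)
  show ?case
  proof (cases k)
    case 0
    then show ?thesis using separated_root.M_0 by (intro exI[of _ 0]) auto
  next
    case (Suc j)
    then have "\<forall>i\<in>{..j}. \<exists>A\<ge>0. \<forall>q N l \<tau>. separated_root q N l \<sigma> \<longrightarrow> 0 \<le> \<tau> \<longrightarrow> \<tau> \<le> \<sigma> / 8 \<longrightarrow>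
      cmod (separated_root.M q N l \<sigma> i \<tau> - of_real (separated_root.C q N l i \<tau>)) \<le> A * (\<tau> + 1 / real N) * \<tau> ^ i"
      using less.IH by auto
    from bchoice[OF this] obtain A where A0: "\<forall>i\<in>{..j}. 0 \<le> A i \<and> (\<forall>q N l \<tau>. separated_root q N l \<sigma> \<longrightarrow> 0 \<le> \<tau> \<longrightarrow> \<tau> \<le> \<sigma> / 8 \<longrightarrow>
      cmod (separated_root.M q N l \<sigma> i \<tau> - of_real (separated_root.C q N l i \<tau>)) \<le> A i * (\<tau> + 1 / real N) * \<tau> ^ i)"
      by blast
    then have A: "\<And>i. i \<le> j \<Longrightarrow> 0 \<le> A i"
      "\<And>i q N l \<tau>. i \<le> j \<Longrightarrow> separated_root q N l \<sigma> \<Longrightarrow> 0 \<le> \<tau> \<Longrightarrow> \<tau> \<le> \<sigma> / 8 \<Longrightarrow>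
      cmod (separated_root.M q N l \<sigma> i \<tau> - of_real (separated_root.C q N l i \<tau>)) \<le> A i * (\<tau> + 1 / real N) * \<tau> ^ i"
      by (meson atMost_iff)+
    define B where "B = real (Suc j) * ((\<Sum>i<j. A i * 2 ^ (j - 1 - i) + \<bar>semicircle_moment i\<bar> * A (j - 1 - i))
      + real j * 2 ^ (j - 1) + 4 * 2 ^ j / \<sigma>)"
    have "0 \<le> B"
      unfolding B_def using A(1) \<sigma> by (intro mult_nonneg_nonneg add_nonneg_nonneg sum_nonneg divide_nonneg_nonneg) auto
    moreover have "cmod (separated_root.M q N l \<sigma> k \<tau> - of_real (separated_root.C q N l k \<tau>)) \<le> B * (\<tau> + 1 / real N) * \<tau> ^ k"
      if "separated_root q N l \<sigma>" "0 \<le> \<tau>" "\<tau> \<le> \<sigma> / 8" for q N l \<tau>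
      unfolding Suc B_def
      using separated_root.norm_M_minus_C_step[OF that(1), of j A \<tau>] A that by blast
    ultimately show ?thesis by blast
  qed
qed

section \<open>Moments of the semicircle law\<close>

text \<open>\<open>C = 1 + X\<^sup>2 C\<^sup>2\<close> gives \<open>(1 - 2 X\<^sup>2 C)\<^sup>2 = 1 - 4 X\<^sup>2\<close>; differentiating this turns the
  convolution recursion into a two-term recursion.\<close>

lemma semicircle_moment_rec:
  "(real k + 4) * semicircle_moment (Suc (Suc k)) = 4 * (real k + 1) * semicircle_moment k"
proof -
  define F :: "real fps" where "F = Abs_fps semicircle_moment"
  define y where "y = fps_X ^ 2 * F"
  define D where "D = 1 - 2 * y"
  have F: "F = 1 + fps_X ^ 2 * F ^ 2"
  proof (rule fps_ext)
    fix n
    show "fps_nth F n = fps_nth (1 + fps_X ^ 2 * F ^ 2) n"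
    proof (cases n)
      case (Suc m)
      show ?thesis
      proof (cases m)
        case 0
        then show ?thesis using Suc
          by (simp add: F_def semicircle_moment.simps(2) fps_X_power_mult_nth)
      next
        case (Suc j)
        then have n: "n = j + 2" using \<open>n = Suc m\<close> by simp
        have "fps_nth (fps_X ^ 2 * F ^ 2) n = fps_nth (F * F) j"
          unfolding n fps_X_power_mult_nth power2_eq_square[of F] by simp
        also have "\<dots> = (\<Sum>i\<le>j. semicircle_moment i * semicircle_moment (j - i))"
          by (simp add: fps_mult_nth F_def atLeast0AtMost)
        also have "\<dots> = fps_nth F n"
          using n semicircle_moment.simps(2)[of "Suc j"] by (simp add: F_def lessThan_Suc_atMost)
        finally show ?thesis using n by simp
      qed
    qed (simp add: F_def fps_X_power_mult_nth)
  qed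
  have "y = fps_X ^ 2 * (1 + fps_X ^ 2 * F ^ 2)" unfolding y_def by (subst (1) F) (rule refl)
  also have "\<dots> = fps_X ^ 2 + y * y"
    by (simp only: y_def distrib_left mult_1_right power2_eq_square mult_ac)
  finally have y: "y - y * y = fps_X ^ 2" by (rule diff_eq_eq[THEN iffD2])
  have "D * D = 1 - 4 * (y - y * y)" unfolding D_def by (simp add: algebra_simps)
  then have D2: "D * D = 1 - 4 * fps_X ^ 2" unfolding y .
  define E where "E = fps_deriv D"
  have "fps_deriv (D * D) = 2 * (D * E)"
    by (simp add: E_def mult.commute)
  moreover have "fps_deriv (1 - 4 * fps_X ^ 2 :: real fps) = 2 * (- 4 * fps_X)"
    by (simp add: fps_deriv_power power2_eq_square)
  ultimately have "2 * (D * E) = 2 * (- 4 * fps_X)" unfolding D2 by (rule trans[OF sym])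
  moreover have "u = v" if "2 * u = 2 * v" for u v :: "real fps" using that by simp
  ultimately have DE: "D * E = - 4 * fps_X" by blast
  \<comment> \<open>Multiplying D E = -4 X by D replaces D D by its known value and leaves a linear
    equation with polynomial coefficients.\<close>
  have "(1 - 4 * fps_X ^ 2) * E = D * (D * E)" by (simp only: D2[symmetric] mult.assoc)
  also have "\<dots> = - 4 * (fps_X * D)" unfolding DE by (simp only: mult_ac)
  finally have ode: "(1 - 4 * fps_X ^ 2) * E = - 4 * (fps_X * D)" .
  have y_nth: "fps_nth y (Suc (Suc i)) = semicircle_moment i" for i
    by (simp add: y_def F_def fps_X_power_mult_nth)
  have D_nth: "fps_nth D (Suc (Suc i)) = - 2 * semicircle_moment i" for i
    using y_nth[of i] by (simp add: D_def fps_numeral_fps_const)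
  have E_nth: "fps_nth E i = real (Suc i) * fps_nth D (Suc i)" for i
    by (simp add: E_def fps_deriv_nth)
  have "E - fps_const 4 * (fps_X ^ 2 * E) = fps_const (- 4) * (fps_X * D)"
    using ode by (simp add: fps_numeral_fps_const left_diff_distrib mult.assoc flip: fps_const_neg)
  then have "fps_nth (E - fps_const 4 * (fps_X ^ 2 * E)) (Suc (Suc (Suc k)))
      = fps_nth (fps_const (- 4) * (fps_X * D)) (Suc (Suc (Suc k)))" by simp
  then have "fps_nth E (Suc (Suc (Suc k))) - 4 * fps_nth E (Suc k) = - 4 * fps_nth D (Suc (Suc k))"
    by (simp add: fps_X_power_mult_nth)
  then have "(real k + 4) * (- 2 * semicircle_moment (Suc (Suc k))) - 4 * ((real k + 2) * (- 2 * semicircle_moment k))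
      = - 4 * (- 2 * semicircle_moment k)"
    unfolding E_nth D_nth by (simp add: add_ac)
  then show ?thesis by (simp add: algebra_simps)
qed

text \<open>Meant on [-2, 2], to which all integrals below are restricted; \<open>sqrt\<close> takes
  negative values at negative arguments.\<close>

definition semicircle_density :: "real \<Rightarrow> real" where
  "semicircle_density x = sqrt (4 - x\<^sup>2) / (2 * pi)"

text \<open>The integrand is the derivative of x^k (4 - x^2)^(3/2), which vanishes at both ends.
  This is the recursion of \<open>semicircle_moment_rec\<close> for the integrals.\<close>

lemma semicircle_moment_step:
  "((\<lambda>x. (4 * real k * x ^ (k - 1) - (real k + 3) * x ^ (k + 1)) * sqrt (4 - x\<^sup>2)) has_integral 0) {-2..2}"
proof -
  define F where "F = (\<lambda>x::real. x ^ k * (4 - x\<^sup>2) * sqrt (4 - x\<^sup>2))"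
  have "((\<lambda>x. (4 * real k * x ^ (k - 1) - (real k + 3) * x ^ (k + 1)) * sqrt (4 - x\<^sup>2)) has_integral (F 2 - F (-2))) {-2..2}"
  proof (rule fundamental_theorem_of_calculus_interior)
    show "continuous_on {-2..2} F" unfolding F_def by (intro continuous_intros)
    fix x :: real assume x: "x \<in> {-2<..<2}"
    then have "\<bar>x\<bar> < 2" by auto
    then have "x\<^sup>2 < 2\<^sup>2" by (metis abs_ge_zero power2_abs power_strict_mono zero_less_numeral)
    then have pos: "0 < 4 - x\<^sup>2" by simp
    define s where "s = sqrt (4 - x\<^sup>2)"
    have s: "s * s = 4 - x\<^sup>2" "s \<noteq> 0" using pos by (auto simp: s_def)
    have "(F has_real_derivative ((real k * x ^ (k - 1)) * (4 - x\<^sup>2) - x ^ k * (2 * x)) * s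
        + x ^ k * (4 - x\<^sup>2) * (- (2 * x) * (inverse s / 2))) (at x)"
      unfolding F_def using pos by (auto intro!: derivative_eq_intros simp: s_def algebra_simps)
    also have "x ^ k * (4 - x\<^sup>2) * (- (2 * x) * (inverse s / 2)) = - (x ^ (k + 1)) * s"
      unfolding s(1)[symmetric] using s(2) by (simp add: field_simps)
    also have "((real k * x ^ (k - 1)) * (4 - x\<^sup>2) - x ^ k * (2 * x)) * s + - (x ^ (k + 1)) * s
        = (4 * real k * x ^ (k - 1) - (real k + 3) * x ^ (k + 1)) * s"
      by (cases k) (simp_all add: algebra_simps power2_eq_square)
    finally show "(F has_vector_derivative (4 * real k * x ^ (k - 1) - (real k + 3) * x ^ (k + 1)) * sqrt (4 - x\<^sup>2)) (at x)"
      by (simp add: has_real_derivative_iff_has_vector_derivative s_def)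
  qed simp
  then show ?thesis by (simp add: F_def)
qed

lemma semicircle_area: "((\<lambda>x. sqrt (4 - x\<^sup>2)) has_integral 2 * pi) {-2..2}"
proof -
  define F where "F = (\<lambda>x::real. x * sqrt (4 - x\<^sup>2) / 2 + 2 * arcsin (x / 2))"
  have "((\<lambda>x. sqrt (4 - x\<^sup>2)) has_integral (F 2 - F (-2))) {-2..2}"
  proof (rule fundamental_theorem_of_calculus_interior)
    show "continuous_on {-2..2} F" unfolding F_def by (intro continuous_intros) auto
    fix x :: real assume x: "x \<in> {-2<..<2}"
    then have "\<bar>x\<bar> < 2" by auto
    then have "x\<^sup>2 < 2\<^sup>2" by (metis abs_ge_zero power2_abs power_strict_mono zero_less_numeral)
    then have pos: "0 < 4 - x\<^sup>2" by simp
    define s where "s = sqrt (4 - x\<^sup>2)"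
    have s: "s * s = 4 - x\<^sup>2" "s > 0" using pos by (auto simp: s_def)
    have "sqrt (1 - (x / 2)\<^sup>2) = sqrt ((4 - x\<^sup>2) / 4)" by (simp add: power_divide field_simps)
    also have "\<dots> = s / 2" by (simp add: s_def real_sqrt_divide)
    finally have s': "sqrt (1 - (x / 2)\<^sup>2) = s / 2" .
    have "((\<lambda>x. arcsin (x / 2)) has_real_derivative inverse (sqrt (1 - (x / 2)\<^sup>2)) * (1 / 2)) (at x)"
      using x by (intro DERIV_chain2[of arcsin] DERIV_arcsin) (auto intro!: derivative_eq_intros)
    then have dA: "((\<lambda>x. arcsin (x / 2)) has_real_derivative inverse (s / 2) * (1 / 2)) (at x)"
      unfolding s' .
    have "((\<lambda>x. sqrt (4 - x\<^sup>2)) has_real_derivative - (2 * x) * (inverse s / 2)) (at x)"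
      using pos by (auto intro!: derivative_eq_intros simp: s_def)
    from DERIV_add[OF DERIV_cdivide[OF DERIV_mult[OF DERIV_ident this], of 2] DERIV_cmult[OF dA, of 2]]
    have "(F has_real_derivative (1 * s + x * (- (2 * x) * (inverse s / 2))) / 2
        + 2 * (inverse (s / 2) * (1 / 2))) (at x)"
      unfolding F_def by (simp add: s_def mult_ac)
    also have "(1 * s + x * (- (2 * x) * (inverse s / 2))) / 2 + 2 * (inverse (s / 2) * (1 / 2))
        = (s * s - x\<^sup>2 + 4) / (2 * s)"
      using s(2) by (simp add: field_simps power2_eq_square)
    also have "\<dots> = s" using s by (simp add: field_simps power2_eq_square)
    finally show "(F has_vector_derivative sqrt (4 - x\<^sup>2)) (at x)"
      by (simp add: has_real_derivative_iff_has_vector_derivative s_def)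
  qed simp
  then show ?thesis by (simp add: F_def)
qed

text \<open>Both sides satisfy the same two-term recursion. The area settles k = 0, and the integral
  recursion at 0 makes the first moment vanish.\<close>

lemma has_integral_semicircle_power:
  "((\<lambda>x. x ^ k * semicircle_density x) has_integral semicircle_moment k) {-2..2}"
proof -
  have int: "(\<lambda>x::real. x ^ k * sqrt (4 - x\<^sup>2)) integrable_on {-2..2}" for k
    by (intro integrable_continuous_real continuous_intros)
  define I where "I = (\<lambda>k. integral {-2..2} (\<lambda>x::real. x ^ k * sqrt (4 - x\<^sup>2)))"
  have I: "((\<lambda>x. x ^ k * sqrt (4 - x\<^sup>2)) has_integral I k) {-2..2}" for k
    unfolding I_def by (rule integrable_integral[OF int])
  have rec: "4 * real k * I (k - 1) - (real k + 3) * I (k + 1) = 0" for k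
  proof -
    have "((\<lambda>x. 4 * real k * (x ^ (k - 1) * sqrt (4 - x\<^sup>2)) - (real k + 3) * (x ^ (k + 1) * sqrt (4 - x\<^sup>2)))
      has_integral (4 * real k * I (k - 1) - (real k + 3) * I (k + 1))) {-2..2}"
      by (intro has_integral_diff has_integral_mult_right I)
    moreover have "4 * real k * (x ^ (k - 1) * s) - (real k + 3) * (x ^ (k + 1) * s)
      = (4 * real k * x ^ (k - 1) - (real k + 3) * x ^ (k + 1)) * s" for x s :: real
      by (simp only: left_diff_distrib mult.assoc)
    ultimately have "((\<lambda>x. (4 * real k * x ^ (k - 1) - (real k + 3) * x ^ (k + 1)) * sqrt (4 - x\<^sup>2))
      has_integral (4 * real k * I (k - 1) - (real k + 3) * I (k + 1))) {-2..2}"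
      by (simp only:)
    then show ?thesis using semicircle_moment_step[of k] by (rule has_integral_unique)
  qed
  have "I k = 2 * pi * semicircle_moment k"
  proof (induction k rule: induct_nat_012)
    case 0
    then show ?case using semicircle_area by (simp add: I_def integral_unique)
  next
    case 1
    then show ?case using rec[of 0] by (simp add: semicircle_moment.simps(2))
  next
    case (ge2 k)
    have "(real k + 4) * I (Suc (Suc k)) = 4 * (real k + 1) * I k" using rec[of "Suc k"] by (simp add: algebra_simps)
    also have "\<dots> = 2 * pi * (4 * (real k + 1) * semicircle_moment k)" using ge2 by simp
    also have "\<dots> = (real k + 4) * (2 * pi * semicircle_moment (Suc (Suc k)))"
      unfolding semicircle_moment_rec[symmetric] by simp
    finally have "(real k + 4) * I (Suc (Suc k)) = (real k + 4) * (2 * pi * semicircle_moment (Suc (Suc k)))" .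
    moreover have "real k + 4 \<noteq> 0" by linarith
    ultimately show ?case by (simp only: mult_cancel_left) simp
  qed
  then have "((\<lambda>x. x ^ k * sqrt (4 - x\<^sup>2) / (2 * pi)) has_integral semicircle_moment k) {-2..2}"
    using has_integral_divide[OF I[of k], of "2 * pi"] by simp
  then show ?thesis by (simp add: semicircle_density_def)
qed

section \<open>Convergence\<close>

lemma integral_scale_measure:
  fixes f :: "'a \<Rightarrow> real"
  assumes "f \<in> borel_measurable M" "0 \<le> r"
  shows "integral\<^sup>L (scale_measure (ennreal r) M) f = r * integral\<^sup>L M f"
proof -
  have "scale_measure (ennreal r) M = density M (\<lambda>_. ennreal r)"
    by (rule measure_eqI) (simp_all add: emeasure_density_const)
  then show ?thesis using integral_density[of f M "\<lambda>_. r"] assms by simp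
qed

lemma integral_zeros_measure:
  fixes f :: "complex \<Rightarrow> real"
  assumes "p \<noteq> 0" and f: "f \<in> borel_measurable borel"
  shows "integral\<^sup>L (zeros_measure p) f = (\<Sum>z | poly p z = 0. real (order z p) * f z)"
proof -
  have "integral\<^sup>L (zeros_measure p) f = integral\<^sup>L (point_measure {z. poly p z = 0} (\<lambda>z. of_nat (order z p))) f"
    unfolding zeros_measure_def by (rule integral_distr[OF _ f]) (simp add: measurable_point_measure_eq1)
  also have "\<dots> = (\<Sum>z | poly p z = 0. real (order z p) *\<^sub>R f z)"
    using lebesgue_integral_point_measure_finite[of "{z. poly p z = 0}" "\<lambda>z. real (order z p)" f]
      poly_roots_finite[OF assms(1)]
    by (simp add: ennreal_of_nat_eq_real_of_nat)
  finally show ?thesis by simp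
qed

lemma integral_semicircle:
  fixes f :: "complex \<Rightarrow> real"
  assumes f: "continuous_on UNIV f"
  shows "integral\<^sup>L semicircle f = integral {-2..2} (\<lambda>x. f (of_real x) * semicircle_density x)"
proof -
  have fm: "f \<in> borel_measurable borel" using f by (rule borel_measurable_continuous_onI)
  have cf: "continuous_on UNIV (\<lambda>x. f (of_real x))"
    by (intro continuous_on_compose2[OF f] continuous_intros) simp
  define g where "g = (\<lambda>x. indicator {-2..2} x * (sqrt (4 - x\<^sup>2) / (2 * pi)) :: real)"
  have g: "g \<in> borel_measurable borel" unfolding g_def by measurable
  have "0 \<le> g x" for x
  proof (cases "x \<in> {-2..2}")
    case True
    then have "\<bar>x\<bar> \<le> 2" by auto
    then have "x\<^sup>2 \<le> 2\<^sup>2" by (metis abs_ge_zero power2_abs power_mono)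
    then show ?thesis by (simp add: g_def)
  qed (simp add: g_def)
  then have g0: "AE x in lborel. 0 \<le> g x" by simp
  have "integral\<^sup>L semicircle f = integral\<^sup>L (distr (density lborel (\<lambda>x. ennreal (g x))) borel complex_of_real) f"
    by (simp add: semicircle_def g_def)
  also have "\<dots> = integral\<^sup>L (density lborel (\<lambda>x. ennreal (g x))) (\<lambda>x. f (of_real x))"
    by (rule integral_distr[OF _ fm]) simp
  also have "\<dots> = integral\<^sup>L lborel (\<lambda>x. g x *\<^sub>R f (of_real x))"
    by (rule integral_density[OF _ _ g0]) (use g cf in \<open>auto intro: borel_measurable_continuous_onI\<close>)
  also have "\<dots> = (LINT x:{-2..2}|lborel. f (of_real x) * semicircle_density x)"
    unfolding set_lebesgue_integral_def
    by (rule Bochner_Integration.integral_cong) (auto simp: g_def semicircle_density_def)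
  also have "\<dots> = integral {-2..2} (\<lambda>x. f (of_real x) * semicircle_density x)"
    by (intro set_borel_integral_eq_integral borel_integrable_atLeastAtMost')
      (unfold semicircle_density_def, intro continuous_intros continuous_on_subset[OF cf], auto)
  finally show ?thesis .
qed

lemma semicircle_integral_approx:
  fixes f :: "complex \<Rightarrow> real"
  assumes f: "continuous_on UNIV f" and close: "\<And>x. x \<in> {-2..2} \<Longrightarrow> \<bar>f (of_real x) - (\<Sum>i\<le>n. c i * x ^ i)\<bar> \<le> e"
  shows "\<bar>integral\<^sup>L semicircle f - (\<Sum>i\<le>n. c i * semicircle_moment i)\<bar> \<le> e"
proof -
  have cf: "continuous_on UNIV (\<lambda>x. f (of_real x))"
    by (intro continuous_on_compose2[OF f] continuous_intros) simp
  have "(\<lambda>x. f (of_real x) * semicircle_density x) integrable_on {-2..2}"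
    unfolding semicircle_density_def
    by (intro integrable_continuous_real continuous_intros continuous_on_subset[OF cf]) auto
  then have F: "((\<lambda>x. f (of_real x) * semicircle_density x) has_integral integral\<^sup>L semicircle f) {-2..2}"
    unfolding integral_semicircle[OF f] by (rule integrable_integral)
  have "((\<lambda>x. \<Sum>i\<le>n. c i * (x ^ i * semicircle_density x)) has_integral (\<Sum>i\<le>n. c i * semicircle_moment i)) {-2..2}"
    by (intro has_integral_sum has_integral_mult_right has_integral_semicircle_power) auto
  from has_integral_diff[OF F this]
  have D: "((\<lambda>x. (f (of_real x) - (\<Sum>i\<le>n. c i * x ^ i)) * semicircle_density x) has_integral
      (integral\<^sup>L semicircle f - (\<Sum>i\<le>n. c i * semicircle_moment i))) {-2..2}"
    by (simp add: left_diff_distrib sum_distrib_right mult.assoc)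
  have E: "((\<lambda>x. e * semicircle_density x) has_integral e * 1) {-2..2}"
    using has_integral_semicircle_power[of 0] by (intro has_integral_mult_right) simp
  have "norm (integral {-2..2} (\<lambda>x. (f (of_real x) - (\<Sum>i\<le>n. c i * x ^ i)) * semicircle_density x))
      \<le> integral {-2..2} (\<lambda>x. e * semicircle_density x)"
  proof (rule integral_norm_bound_integral)
    fix x :: real assume x: "x \<in> {-2..2}"
    then have "\<bar>x\<bar> \<le> 2" by auto
    then have "x\<^sup>2 \<le> 2\<^sup>2" by (metis abs_ge_zero power2_abs power_mono)
    then have "0 \<le> semicircle_density x" by (simp add: semicircle_density_def)
    then show "norm ((f (of_real x) - (\<Sum>i\<le>n. c i * x ^ i)) * semicircle_density x) \<le> e * semicircle_density x"
      using close[OF x] by (simp add: abs_mult mult_right_mono)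
  qed (use D E in blast)+
  then show ?thesis unfolding integral_unique[OF D] integral_unique[OF E] by simp
qed

text \<open>One \<delta> serves all instances with gap \<sigma> and mass b. Rescaled cluster zeros
  stay in a fixed disc and approach the real axis, where f is close to a polynomial governed by the
  moments; all other zeros leave the support of f.\<close>

lemma cluster_integral_estimate:
  fixes f :: "complex \<Rightarrow> real"
  assumes f: "continuous_on UNIV f" and R: "\<And>w. R < cmod w \<Longrightarrow> f w = 0"
    and \<sigma>: "0 < \<sigma>" and b: "0 < b" and e: "0 < e"
  shows "\<exists>\<delta>>0. \<forall>q N l \<tau>. separated_root q N l \<sigma> \<longrightarrow> separated_root.\<beta> q N l = b \<longrightarrow>
    0 < \<tau> \<longrightarrow> \<tau> < \<delta> \<longrightarrow> 1 / real N < \<delta> \<longrightarrow>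
    \<bar>(\<Sum>z | poly (separated_root.P q N \<tau>) z = 0. real (order z (separated_root.P q N \<tau>)) *
      f ((z - l) / of_real (\<tau> * sqrt b))) / real N - b * integral\<^sup>L semicircle f\<bar> \<le> e"
proof -
  \<comment> \<open>Covers the support of the semicircle law and the rescaled cluster, of radius at
    most 2 \<tau> / (\<tau> sqrt(b)).\<close>
  define B where "B = max 2 (2 / sqrt b)"
  \<comment> \<open>Shares of the error: 2 for f against the polynomial on the cluster, 1 for the
    moments, b for the semicircle integral.\<close>
  define e1 where "e1 = e / (3 + b)"
  have e1: "0 < e1" using e b by (simp add: e1_def)
  have cf: "continuous_on UNIV (\<lambda>x. f (of_real x))"
    by (intro continuous_on_compose2[OF f] continuous_intros) simp
  obtain r where r: "real_polynomial_function r" "\<And>x. x \<in> {-B..B} \<Longrightarrow> \<bar>f (of_real x) - r x\<bar> < e1"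
    using Stone_Weierstrass_real_polynomial_function[of "{-B..B}" "\<lambda>x. f (of_real x)" e1]
      continuous_on_subset[OF cf] e1 by auto
  obtain c n where c: "r = (\<lambda>x. \<Sum>i\<le>n. c i * x ^ i)"
    using r(1) unfolding real_polynomial_function_iff_sum by auto
  \<comment> \<open>The polynomial is extended holomorphically and not through Re w, since the
    moments know only powers of z - l.\<close>
  define h where "h = (\<lambda>w. \<Sum>i\<le>n. of_real (c i) * w ^ i :: complex)"
  define g where "g = (\<lambda>w. f w - Re (h w))"
  have h_real: "Re (h (of_real x)) = r x" for x
    by (simp add: h_def c flip: of_real_power of_real_mult)
  have "continuous_on (cball 0 B) g"
    unfolding g_def h_def by (intro continuous_intros continuous_on_subset[OF f]) auto
  then have "uniformly_continuous_on (cball 0 B) g"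
    by (rule compact_uniformly_continuous) simp
  then obtain d where d: "0 < d" "\<And>w w'. w \<in> cball 0 B \<Longrightarrow> w' \<in> cball 0 B \<Longrightarrow> dist w' w < d \<Longrightarrow> dist (g w') (g w) < e1"
    unfolding uniformly_continuous_on_def using e1 by metis
  have "\<forall>k. \<exists>A\<ge>0. \<forall>q N l \<tau>. separated_root q N l \<sigma> \<longrightarrow> 0 \<le> \<tau> \<longrightarrow> \<tau> \<le> \<sigma> / 8 \<longrightarrow>
    cmod (separated_root.M q N l \<sigma> k \<tau> - of_real (separated_root.C q N l k \<tau>)) \<le> A * (\<tau> + 1 / real N) * \<tau> ^ k"
    using moment_estimate[OF \<sigma>] by blast
  then obtain A where A: "\<And>k. 0 \<le> A k" and AM: "\<And>k q N l \<tau>. separated_root q N l \<sigma> \<Longrightarrow> 0 \<le> \<tau> \<Longrightarrow> \<tau> \<le> \<sigma> / 8 \<Longrightarrow>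
    cmod (separated_root.M q N l \<sigma> k \<tau> - of_real (separated_root.C q N l k \<tau>)) \<le> A k * (\<tau> + 1 / real N) * \<tau> ^ k"
    by metis
  define H where "H = (\<Sum>i\<le>n. \<bar>c i\<bar> * (A i / sqrt b ^ i))"
  have H: "0 \<le> H" unfolding H_def using A b by (intro sum_nonneg mult_nonneg_nonneg divide_nonneg_nonneg) auto
  \<comment> \<open>In this order: the zeros are localised; rescaled imaginary parts stay below d;
    zeros outside the cluster are mapped beyond radius |R|; the accumulated moment error, with
    \<tau> + 1 / N < 2 \<delta>, stays below e1.\<close>
  define \<delta> where "\<delta> = Min {\<sigma> / 8, d * \<sigma> * sqrt b / 8, \<sigma> / (2 * sqrt b * (\<bar>R\<bar> + 1)), e1 / (2 * (H + 1))}"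
  have sb: "0 < sqrt b" using b by simp
  have \<delta>: "0 < \<delta>" unfolding \<delta>_def using \<sigma> d(1) sb e1 H by (simp add: add_nonneg_pos)
  have \<delta>_le: "\<delta> \<le> \<sigma> / 8" "\<delta> \<le> d * \<sigma> * sqrt b / 8" "\<delta> \<le> \<sigma> / (2 * sqrt b * (\<bar>R\<bar> + 1))" "\<delta> \<le> e1 / (2 * (H + 1))"
    unfolding \<delta>_def by (intro Min_le; simp)+
  show ?thesis
  proof (intro exI[of _ \<delta>] conjI \<delta> allI impI)
    fix q N l \<tau>
    assume sr: "separated_root q N l \<sigma>" and bq: "separated_root.\<beta> q N l = b" and \<tau>: "0 < \<tau>" "\<tau> < \<delta>" and N\<delta>: "1 / real N < \<delta>"
    interpret separated_root q N l \<sigma> by (rule sr)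
    have \<tau>': "0 \<le> \<tau>" "\<tau> \<le> \<sigma> / 8" using \<tau> \<delta>_le by auto
    define s where "s = \<tau> * sqrt b"
    have s: "0 < s" using \<tau> sb by (simp add: s_def)
    define ord where "ord = (\<lambda>z. real (order z (P \<tau>)))"
    define T where "T = (\<lambda>z. (z - l) / of_real s)"
    define Z where "Z = {z. poly (P \<tau>) z = 0}"
    define Y where "Y = {z. poly (P \<tau>) z = 0 \<and> cmod (z - l) < \<sigma> / 2}"
    have finZ: "finite Z" unfolding Z_def by (rule poly_roots_finite[OF P_nz])
    have N0: "0 < real N" using N by simp
    have far: "f (T z) = 0" if "z \<in> Z - Y" for z
    proof (rule R)
      have "\<sigma> / 2 \<le> cmod (z - l)" using that by (auto simp: Z_def Y_def)
      moreover have "\<bar>R\<bar> < \<sigma> / 2 / s"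
      proof -
        have "\<tau> < \<sigma> / (2 * sqrt b * (\<bar>R\<bar> + 1))" using \<tau> \<delta>_le(3) by simp
        then have "\<tau> * (2 * sqrt b * (\<bar>R\<bar> + 1)) < \<sigma>"
          using sb by (subst (asm) pos_less_divide_eq) (auto intro!: mult_pos_pos)
        then have "(\<bar>R\<bar> + 1) * s < \<sigma> / 2" by (simp add: s_def algebra_simps)
        moreover have "\<bar>R\<bar> * s \<le> (\<bar>R\<bar> + 1) * s" using s by (intro mult_right_mono) auto
        ultimately have "\<bar>R\<bar> * s < \<sigma> / 2" by (rule le_less_trans[rotated])
        then show ?thesis by (rule pos_less_divide_eq[OF s, THEN iffD2])
      qed
      ultimately have "\<bar>R\<bar> < cmod (z - l) / s"
        using s by (smt (verit) divide_right_mono)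
      then show "R < cmod (T z)" using s by (simp add: T_def norm_divide)
    qed
    \<comment> \<open>One \<open>e1\<close> for moving \<open>T z\<close> to its real part by
      uniform continuity, one for the polynomial approximation there.\<close>
    have near: "\<bar>g (T z)\<bar> \<le> 2 * e1" if "z \<in> Y" for z
    proof -
      have z: "poly (P \<tau>) z = 0" "cmod (z - l) < 3 * \<sigma> / 4" using that \<sigma> by (auto simp: Y_def)
      have "cmod (T z) = cmod (z - l) / s" using s by (simp add: T_def norm_divide)
      also have "\<dots> \<le> 2 * \<tau> / s" using root_near[OF \<tau>' z] s by (intro divide_right_mono) auto
      also have "\<dots> = 2 / sqrt b" using \<tau> sb by (simp add: s_def)
      finally have TB: "cmod (T z) \<le> B" by (simp add: B_def)
      have "\<bar>Im (T z)\<bar> = \<bar>Im (z - l)\<bar> / s" using s by (simp add: T_def Im_divide_of_real)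
      also have "\<dots> \<le> 8 * \<tau>\<^sup>2 / \<sigma> / s" using root_Im[OF \<tau>' z] s by (intro divide_right_mono) auto
      also have "\<dots> = 8 * \<tau> / (\<sigma> * sqrt b)" using \<tau> by (simp add: s_def power2_eq_square)
      also have "\<dots> < d"
      proof -
        have "8 * \<tau> < d * (\<sigma> * sqrt b)" using \<tau>(2) \<delta>_le(2) by (simp add: algebra_simps)
        then show ?thesis using \<sigma> sb by (simp add: pos_divide_less_eq)
      qed
      finally have Im: "\<bar>Im (T z)\<bar> < d" .
      define x where "x = Re (T z)"
      have x: "\<bar>x\<bar> \<le> B" using TB abs_Re_le_cmod[of "T z"] by (simp add: x_def)
      have "T z - of_real x = \<i> * of_real (Im (T z))" by (simp add: complex_eq_iff x_def)
      then have "dist (T z) (of_real x) = \<bar>Im (T z)\<bar>" by (simp add: dist_norm norm_mult)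
      then have "dist (g (T z)) (g (of_real x)) < e1" using d(2)[of "of_real x" "T z"] TB x Im by simp
      moreover have "\<bar>g (of_real x)\<bar> < e1" using r(2)[of x] x by (simp add: g_def h_real abs_le_iff)
      ultimately show ?thesis by (simp add: dist_real_def)
    qed
    have "(\<Sum>z\<in>Z. ord z * f (T z)) = (\<Sum>z\<in>Y. ord z * f (T z))"
      by (rule sum.mono_neutral_right[OF finZ]) (use far in \<open>auto simp: Y_def Z_def\<close>)
    also have "\<dots> = (\<Sum>z\<in>Y. ord z * g (T z)) + Re (\<Sum>z\<in>Y. of_real (ord z) * h (T z))"
      by (simp add: g_def sum.distrib[symmetric] algebra_simps)
    also have "(\<Sum>z\<in>Y. of_real (ord z) * h (T z)) = (\<Sum>i\<le>n. of_real (c i) * (of_nat N * M i \<tau> / of_real s ^ i))"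
    proof -
      have "(\<Sum>z\<in>Y. of_real (ord z) * h (T z)) = (\<Sum>i\<le>n. \<Sum>z\<in>Y. of_real (c i) * (of_real (ord z) * (z - l) ^ i / of_real s ^ i))"
        unfolding h_def sum_distrib_left T_def power_divide
        by (subst sum.swap) (simp add: mult_ac)
      also have "\<dots> = (\<Sum>i\<le>n. of_real (c i) * (near_sum (P \<tau>) l (\<sigma> / 2) i / of_real s ^ i))"
        by (simp only: near_sum_def Y_def ord_def of_real_of_nat_eq sum_distrib_left[symmetric] sum_divide_distrib[symmetric])
      finally show ?thesis using N by (simp add: M_def)
    qed
    finally have sum_eq: "(\<Sum>z\<in>Z. ord z * f (T z)) / real N = (\<Sum>z\<in>Y. ord z * g (T z)) / real N
        + Re (\<Sum>i\<le>n. of_real (c i) * (M i \<tau> / of_real s ^ i))"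
    proof -
      assume *: "(\<Sum>z\<in>Z. ord z * f (T z)) = (\<Sum>z\<in>Y. ord z * g (T z)) + Re (\<Sum>i\<le>n. of_real (c i) * (of_nat N * M i \<tau> / of_real s ^ i))"
      have "(\<Sum>i\<le>n. of_real (c i) * (of_nat N * M i \<tau> / of_real s ^ i))
          = of_real (real N) * (\<Sum>i\<le>n. of_real (c i) * (M i \<tau> / of_real s ^ i))"
        by (simp add: sum_distrib_left mult_ac)
      then show ?thesis unfolding * using N0 by (simp add: add_divide_distrib)
    qed
    have 1: "\<bar>(\<Sum>z\<in>Y. ord z * g (T z)) / real N\<bar> \<le> 2 * e1"
    proof -
      have "\<bar>\<Sum>z\<in>Y. ord z * g (T z)\<bar> \<le> (\<Sum>z\<in>Y. ord z * (2 * e1))"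
        by (rule order_trans[OF sum_abs], rule sum_mono)
          (use near in \<open>auto simp: abs_mult ord_def intro!: mult_left_mono\<close>)
      also have "\<dots> \<le> real N * (2 * e1)"
        unfolding sum_distrib_right[symmetric] ord_def Y_def using e1 \<tau>'
        by (intro mult_right_mono sum_order_le) auto
      finally show ?thesis using N0 by (simp add: pos_divide_le_eq mult.commute)
    qed
    have 2: "\<bar>Re (\<Sum>i\<le>n. of_real (c i) * (M i \<tau> / of_real s ^ i)) - b * (\<Sum>i\<le>n. c i * semicircle_moment i)\<bar> \<le> e1"
    proof -
      have "cmod (of_real (c i) * (M i \<tau> / of_real s ^ i) - of_real (b * (c i * semicircle_moment i)))
          \<le> \<bar>c i\<bar> * (A i / sqrt b ^ i) * (\<tau> + 1 / real N)" for i
      proof -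
        have C: "C i \<tau> = s ^ i * (b * semicircle_moment i)" by (simp add: C_def bq s_def mult_ac)
        have "M i \<tau> / of_real s ^ i - of_real (b * semicircle_moment i) = (M i \<tau> - of_real (C i \<tau>)) / of_real s ^ i"
          using s by (simp add: C diff_divide_distrib)
        then have "cmod (M i \<tau> / of_real s ^ i - of_real (b * semicircle_moment i)) \<le> A i * (\<tau> + 1 / real N) * \<tau> ^ i / s ^ i"
          using AM[OF sr \<tau>', of i] s by (simp add: norm_divide norm_power divide_right_mono)
        also have "\<dots> = A i / sqrt b ^ i * (\<tau> + 1 / real N)"
          using \<tau> by (simp add: s_def power_mult_distrib)
        finally have "\<bar>c i\<bar> * cmod (M i \<tau> / of_real s ^ i - of_real (b * semicircle_moment i))
            \<le> \<bar>c i\<bar> * (A i / sqrt b ^ i * (\<tau> + 1 / real N))" by (rule mult_left_mono) simp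
        moreover have "of_real (c i) * (M i \<tau> / of_real s ^ i) - of_real (b * (c i * semicircle_moment i))
            = of_real (c i) * (M i \<tau> / of_real s ^ i - of_real (b * semicircle_moment i))"
          by (simp add: algebra_simps)
        ultimately show ?thesis by (simp only: norm_mult norm_of_real mult.assoc)
      qed
      then have "cmod (\<Sum>i\<le>n. of_real (c i) * (M i \<tau> / of_real s ^ i) - of_real (b * (c i * semicircle_moment i)))
          \<le> (\<Sum>i\<le>n. \<bar>c i\<bar> * (A i / sqrt b ^ i) * (\<tau> + 1 / real N))"
        by (intro sum_norm_le) auto
      also have "\<dots> = H * (\<tau> + 1 / real N)" by (simp only: H_def sum_distrib_right)
      also have "\<dots> \<le> (H + 1) * (2 * \<delta>)" using H \<tau> N\<delta> by (intro mult_mono) auto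
      also have "\<dots> \<le> e1" using \<delta>_le(4) H by (simp add: pos_le_divide_eq add_nonneg_pos mult_ac)
      finally have "cmod ((\<Sum>i\<le>n. of_real (c i) * (M i \<tau> / of_real s ^ i)) - of_real (b * (\<Sum>i\<le>n. c i * semicircle_moment i))) \<le> e1"
        by (simp only: sum_subtractf of_real_sum[symmetric] sum_distrib_left)
      from order_trans[OF abs_Re_le_cmod this] show ?thesis by simp
    qed
    have "\<bar>integral\<^sup>L semicircle f - (\<Sum>i\<le>n. c i * semicircle_moment i)\<bar> \<le> e1"
    proof (rule semicircle_integral_approx[OF f])
      fix x :: real assume "x \<in> {-2..2}"
      then have "x \<in> {-B..B}" by (auto simp: B_def)
      from r(2)[OF this] show "\<bar>f (of_real x) - (\<Sum>i\<le>n. c i * x ^ i)\<bar> \<le> e1" by (simp add: c)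
    qed
    then have 3: "\<bar>b * integral\<^sup>L semicircle f - b * (\<Sum>i\<le>n. c i * semicircle_moment i)\<bar> \<le> b * e1"
      using b by (simp add: abs_mult flip: right_diff_distrib)
    have "(3 + b) * e1 = e" using b by (simp add: e1_def)
    then have "2 * e1 + e1 + b * e1 = e" by (simp add: distrib_right)
    with 1 2 3 sum_eq have "\<bar>(\<Sum>z\<in>Z. ord z * f (T z)) / real N - b * integral\<^sup>L semicircle f\<bar> \<le> e"
      by linarith
    then show "\<bar>(\<Sum>z | poly (P \<tau>) z = 0. real (order z (P \<tau>)) * f ((z - l) / of_real (\<tau> * sqrt b))) / real N
        - b * integral\<^sup>L semicircle f\<bar> \<le> e"
      by (simp only: Z_def ord_def T_def s_def)
  qed
qed

section \<open>Roots of the powers of the base polynomial\<close>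

lemma base_poly_power_split:
  assumes "j \<in> {1..d}"
  shows "base_poly d lam a ^ n = [:- lam j, 1:] ^ (a j * n) * (\<Prod>i\<in>{1..d} - {j}. [:- lam i, 1:] ^ a i) ^ n"
proof -
  have "base_poly d lam a = [:- lam j, 1:] ^ a j * (\<Prod>i\<in>{1..d} - {j}. [:- lam i, 1:] ^ a i)"
    unfolding base_poly_def using assms by (intro prod.remove) auto
  then show ?thesis by (simp only: power_mult_distrib power_mult)
qed

lemma base_poly_nonzero: "base_poly d lam a \<noteq> 0"
  by (auto simp: base_poly_def)

lemma degree_base_poly_power: "degree (base_poly d lam a ^ n) = total_mult d a * n"
proof -
  have "degree (base_poly d lam a) = (\<Sum>j=1..d. degree ([:- lam j, 1:] ^ a j))"
    unfolding base_poly_def by (intro degree_prod_sum_eq) auto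
  then have "degree (base_poly d lam a) = total_mult d a"
    by (simp add: total_mult_def degree_linear_power)
  then show ?thesis using base_poly_nonzero by (simp add: degree_power_eq)
qed

lemma order_base_poly_power:
  assumes j: "j \<in> {1..d}" and inj: "inj_on lam {1..d}"
  shows "order (lam j) (base_poly d lam a ^ n) = a j * n"
proof -
  define R where "R = (\<Prod>i\<in>{1..d} - {j}. [:- lam i, 1:] ^ a i) ^ n"
  have "poly R (lam j) \<noteq> 0"
    using inj_onD[OF inj, of j] j by (auto simp: R_def poly_prod)
  then have "order (lam j) R = 0" "R \<noteq> 0" by (auto intro: order_0I)
  then show ?thesis
    unfolding base_poly_power_split[OF j] R_def[symmetric]
    by (subst order_mult) (auto simp: order_power_n_n)
qed

text \<open>Powers change the multiplicities but not the set of roots, so one \<sigma> serves all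
  n.\<close>

lemma separated_root_base_poly:
  assumes j: "j \<in> {1..d}" and inj: "inj_on lam {1..d}" and a: "\<And>i. i \<in> {1..d} \<Longrightarrow> a i \<ge> 1"
  obtains \<sigma> where "0 < \<sigma>"
    "\<And>n. 1 \<le> n \<Longrightarrow> separated_root (base_poly d lam a ^ n) (total_mult d a * n) (lam j) \<sigma>"
proof -
  \<comment> \<open>The inserted 1 keeps the minimum defined when d = 1.\<close>
  define S where "S = insert 1 ((\<lambda>i. cmod (lam i - lam j)) ` ({1..d} - {j}))"
  have fin: "finite S" "S \<noteq> {}" by (simp_all add: S_def)
  have "0 < s" if "s \<in> S" for s
    using that inj_onD[OF inj, of _ j] j by (auto simp: S_def)
  then have pos: "0 < Min S" using fin by simp
  have "1 \<le> a j" using a j by simp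
  also have "a j \<le> total_mult d a"
    unfolding total_mult_def using j by (intro member_le_sum) auto
  finally have \<alpha>: "0 < total_mult d a" by simp
  show thesis
  proof (rule that[OF pos])
    fix n :: nat assume n: "1 \<le> n"
    show "separated_root (base_poly d lam a ^ n) (total_mult d a * n) (lam j) (Min S)"
    proof
      show "degree (base_poly d lam a ^ n) = total_mult d a * n" by (rule degree_base_poly_power)
      show "0 < total_mult d a * n" using \<alpha> n by simp
      show "0 < Min S" by (rule pos)
      fix y assume "poly (base_poly d lam a ^ n) y = 0" "y \<noteq> lam j"
      then obtain i where "i \<in> {1..d}" "y = lam i"
        by (auto simp: base_poly_def poly_prod)
      then show "Min S \<le> cmod (y - lam j)"
        using \<open>y \<noteq> lam j\<close> fin by (intro Min_le) (auto simp: S_def)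
    qed
  qed
qed

lemma integral_empirical_zeros:
  fixes f :: "complex \<Rightarrow> real"
  assumes f: "f \<in> borel_measurable borel" and p: "evolved_poly d lam a n t \<noteq> 0"
  shows "integral\<^sup>L (empirical_zeros d lam a n t) f =
    (\<Sum>z | poly (evolved_poly d lam a n t) z = 0. real (order z (evolved_poly d lam a n t)) * f z)
      / real (total_mult d a * n)"
proof -
  have "f \<in> borel_measurable (zeros_measure (evolved_poly d lam a n t))"
    using f by (simp add: zeros_measure_def)
  then show ?thesis
    unfolding empirical_zeros_def
    by (simp add: integral_scale_measure integral_zeros_measure[OF p f])
qed

theorem theorem2p6:
  fixes d :: nat and lam :: "nat \<Rightarrow> complex" and a :: "nat \<Rightarrow> nat"
    and \<mu> :: "real \<Rightarrow> complex measure" and j :: nat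
  assumes "inj_on lam {1..d}"
    and "\<And>i. i \<in> {1..d} \<Longrightarrow> a i \<ge> 1"
    and "\<And>t. t > 0 \<Longrightarrow> prob_space (\<mu> t)"
    and "\<And>t. t > 0 \<Longrightarrow> sets (\<mu> t) = sets borel"
    and "\<And>t. t > 0 \<Longrightarrow> weakly_tendsto (\<lambda>n. empirical_zeros d lam a n t) (\<mu> t) sequentially"
    and "j \<in> {1..d}"
  shows "vaguely_tendsto
    (\<lambda>t. distr (\<mu> t) borel
       (\<lambda>z. (z - lam j) / complex_of_real (sqrt (t * real (a j) / real (total_mult d a)))))
    (scale_measure (ennreal (real (a j) / real (total_mult d a))) semicircle)
    (at_right 0)"
  unfolding vaguely_tendsto_def
proof (intro allI impI)
  fix f :: "complex \<Rightarrow> real"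
  assume f: "continuous_on UNIV f" and supp: "compact (closure {x. f x \<noteq> 0})"
  have fm: "f \<in> borel_measurable borel" using f by (rule borel_measurable_continuous_onI)
  obtain R where R: "\<And>x. x \<in> closure {x. f x \<noteq> 0} \<Longrightarrow> cmod x \<le> R"
    using compact_imp_bounded[OF supp] by (auto simp: bounded_iff)
  have R': "f w = 0" if "R < cmod w" for w
  proof (rule ccontr)
    assume "f w \<noteq> 0"
    then have "w \<in> closure {x. f x \<noteq> 0}" by (intro closure_subset[THEN subsetD]) simp
    then show False using R that by fastforce
  qed
  \<comment> \<open>Weak convergence is tested on bounded functions only; compact support makes f
    one of them.\<close>
  have bdd: "bounded (range f)"
  proof -
    have "compact (f ` closure {x. f x \<noteq> 0})"
      by (rule compact_continuous_image[OF continuous_on_subset[OF f] supp]) simp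
    then have "bounded (insert 0 (f ` closure {x. f x \<noteq> 0}))" by (simp add: compact_imp_bounded)
    then show ?thesis
    proof (rule bounded_subset)
      show "range f \<subseteq> insert 0 (f ` closure {x. f x \<noteq> 0})"
        using closure_subset[of "{x. f x \<noteq> 0}"] by fast
    qed
  qed
  define \<alpha> where "\<alpha> = total_mult d a"
  define b where "b = real (a j) / real \<alpha>"
  have "\<exists>\<sigma>>0. \<forall>n\<ge>1. separated_root (base_poly d lam a ^ n) (\<alpha> * n) (lam j) \<sigma>"
    unfolding \<alpha>_def by (rule separated_root_base_poly[where a = a, OF assms(6,1,2)]) auto
  then obtain \<sigma> where \<sigma>: "0 < \<sigma>" and sr: "\<And>n. 1 \<le> n \<Longrightarrow> separated_root (base_poly d lam a ^ n) (\<alpha> * n) (lam j) \<sigma>"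
    by blast
  have \<alpha>: "0 < \<alpha>" using separated_root.N[OF sr[of 1]] by simp
  have b: "0 < b" using assms(2)[OF assms(6)] \<alpha> by (simp add: b_def)
  have \<beta>: "separated_root.\<beta> (base_poly d lam a ^ n) (\<alpha> * n) (lam j) = b" if "1 \<le> n" for n
    using that separated_root.\<beta>_def[OF sr[OF that]] order_base_poly_power[OF assms(6,1)]
    by (simp add: b_def)
  define T where "T = (\<lambda>t z. (z - lam j) / complex_of_real (sqrt (t * b)))"
  have Tc: "continuous_on UNIV (T t)" if "0 < t" for t
    unfolding T_def using that b by (intro continuous_intros) auto
  have lhs: "integral\<^sup>L (distr (\<mu> t) borel (T t)) f = integral\<^sup>L (\<mu> t) (\<lambda>z. f (T t z))" if t: "0 < t" for t
  proof (rule integral_distr[OF _ fm])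
    show "T t \<in> measurable (\<mu> t) borel"
      unfolding measurable_cong_sets[OF assms(4)[OF t] refl] by (rule borel_measurable_continuous_onI[OF Tc[OF t]])
  qed
  have lim: "(\<lambda>n. integral\<^sup>L (empirical_zeros d lam a n t) (\<lambda>z. f (T t z))) \<longlonglongrightarrow> integral\<^sup>L (\<mu> t) (\<lambda>z. f (T t z))"
    if t: "0 < t" for t
  proof -
    have "continuous_on UNIV (\<lambda>z. f (T t z))"
      by (rule continuous_on_compose2[OF f Tc[OF t]]) simp
    moreover have "bounded (range (\<lambda>z. f (T t z)))"
      by (rule bounded_subset[OF bdd]) auto
    ultimately show ?thesis using assms(5)[OF t] unfolding weakly_tendsto_def by blast
  qed
  have rhs: "integral\<^sup>L (scale_measure (ennreal b) semicircle) f = b * integral\<^sup>L semicircle f"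
    using fm b by (intro integral_scale_measure) (auto simp: semicircle_def)
  have "((\<lambda>t. integral\<^sup>L (distr (\<mu> t) borel (T t)) f) \<longlongrightarrow> b * integral\<^sup>L semicircle f) (at_right 0)"
  proof (rule tendstoI)
    fix e :: real assume "0 < e"
    then have e: "0 < e / 2" by simp
    obtain \<delta> where \<delta>: "0 < \<delta>" and est: "\<And>q N l \<tau>. separated_root q N l \<sigma> \<Longrightarrow> separated_root.\<beta> q N l = b \<Longrightarrow>
      0 < \<tau> \<Longrightarrow> \<tau> < \<delta> \<Longrightarrow> 1 / real N < \<delta> \<Longrightarrow>
      \<bar>(\<Sum>z | poly (separated_root.P q N \<tau>) z = 0. real (order z (separated_root.P q N \<tau>)) *
        f ((z - l) / of_real (\<tau> * sqrt b))) / real N - b * integral\<^sup>L semicircle f\<bar> \<le> e / 2"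
      using cluster_integral_estimate[where R = R, OF f R' \<sigma> b e] by blast
    obtain n0 :: nat where n0: "1 / \<delta> < real n0" using reals_Archimedean2 by blast
    \<comment> \<open>At fixed t the estimate holds for all large n and so passes to the limit in n.
      As \<delta> depends on neither t nor n, t may then tend to 0; t < \<delta>^2 means \<tau> <
      \<delta>.\<close>
    have main: "\<bar>integral\<^sup>L (\<mu> t) (\<lambda>z. f (T t z)) - b * integral\<^sup>L semicircle f\<bar> \<le> e / 2"
      if t: "0 < t" "t < \<delta>\<^sup>2" for t
    proof -
      have \<tau>: "0 < sqrt t" "sqrt t < \<delta>" using t \<delta> real_less_lsqrt[of \<delta> t] by auto
      have "\<bar>integral\<^sup>L (empirical_zeros d lam a n t) (\<lambda>z. f (T t z)) - b * integral\<^sup>L semicircle f\<bar> \<le> e / 2"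
        if n: "max 1 n0 \<le> n" for n
      proof -
        have n1: "1 \<le> n" using n by simp
        have "1 / \<delta> < real n" using n0 n by simp
        also have "\<dots> \<le> real (\<alpha> * n)" unfolding of_nat_le_iff using \<alpha> by (cases \<alpha>) auto
        finally have "1 / \<delta> < real (\<alpha> * n)" .
        then have N: "1 / real (\<alpha> * n) < \<delta>" using \<delta> \<alpha> n1 by (simp add: field_simps)
        \<comment> \<open>The time t / (2 \<alpha> n) is \<tau>^2 / (2 N) with \<tau> = sqrt t and N
          = \<alpha> n.\<close>
        have P: "evolved_poly d lam a n t = separated_root.P (base_poly d lam a ^ n) (\<alpha> * n) (sqrt t)"
          unfolding separated_root.P_def[OF sr[OF n1]] using t
          by (simp add: evolved_poly_def \<alpha>_def mult.assoc)
        have "evolved_poly d lam a n t \<noteq> 0" unfolding P by (rule separated_root.P_nz[OF sr[OF n1]])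
        moreover have "(\<lambda>z. f (T t z)) \<in> borel_measurable borel"
          using measurable_compose[OF borel_measurable_continuous_onI[OF Tc[OF t(1)]] fm] .
        ultimately have "integral\<^sup>L (empirical_zeros d lam a n t) (\<lambda>z. f (T t z)) =
          (\<Sum>z | poly (evolved_poly d lam a n t) z = 0. real (order z (evolved_poly d lam a n t)) * f (T t z)) / real (\<alpha> * n)"
          unfolding \<alpha>_def by (intro integral_empirical_zeros)
        then show ?thesis
          using est[OF sr[OF n1] \<beta>[OF n1] \<tau> N] by (simp only: P T_def real_sqrt_mult)
      qed
      then have "\<forall>\<^sub>F n in sequentially. \<bar>integral\<^sup>L (empirical_zeros d lam a n t) (\<lambda>z. f (T t z)) - b * integral\<^sup>L semicircle f\<bar> \<le> e / 2"
        unfolding eventually_sequentially by blast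
      then show ?thesis
        by (rule tendsto_upperbound[OF tendsto_rabs[OF tendsto_diff[OF lim[OF t(1)] tendsto_const]]]) simp
    qed
    have "\<forall>\<^sub>F t in at_right 0. 0 < t \<and> t < \<delta>\<^sup>2"
      unfolding eventually_at_right_field using \<delta> by (intro exI[of _ "\<delta>\<^sup>2"]) auto
    then show "\<forall>\<^sub>F t in at_right 0. dist (integral\<^sup>L (distr (\<mu> t) borel (T t)) f) (b * integral\<^sup>L semicircle f) < e"
    proof eventually_elim
      case (elim t)
      then show ?case using main[of t] lhs[of t] \<open>0 < e\<close> by (simp add: dist_real_def)
    qed
  qed
  then show "((\<lambda>t. integral\<^sup>L (distr (\<mu> t) borel
       (\<lambda>z. (z - lam j) / complex_of_real (sqrt (t * real (a j) / real (total_mult d a))))) f)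
    \<longlongrightarrow> integral\<^sup>L (scale_measure (ennreal (real (a j) / real (total_mult d a))) semicircle) f) (at_right 0)"
    unfolding rhs[unfolded b_def \<alpha>_def] T_def b_def \<alpha>_def times_divide_eq_right .
qed

end
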